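(* The type $\mathsf{bool}$ is bridge-discrete.
   Context: We work in parametric cubical type theory: Martin-Löf type theory with $\Sigma$-, $\Pi$-types and a univalent universe $\mathcal{U}$ of Kan types, extended by structural path dimensions (variables $x,y,z$, constants $0,1$) with path types $\mathsf{Path}_{x.A}(M_0,M_1)$ and Kan operations including coercion $\mathsf{coe}^{r\to s}_{z.A}$, so paths behave like homotopy-type-theoretic identity types ($\mathsf{isEquiv}$ as there), and by substructural bridge dimensions (weakening and exchange, no contraction; variables $\mathbf{x},\mathbf{y},\dots$, constants $\mathbf{0},\mathbf{1}$) with $\mathsf{Bridge}_{\mathbf{x}.A}(M_{\mathbf{0}},M_{\mathbf{1}})$ having elements $\lambda^{\mathbf{x}}P$, application to fresh dimensions, $\beta$, endpoint rules and $\eta$; $\mathsf{Bridge}_A$ is the case of constant $A$. The theory has Gel-types $\mathsf{Gel}_{\mathbf{r}}(A,B,a.b.R)$ (equal to $A$ at $\mathbf{0}$ and $B$ at $\mathbf{1}$, constructor $\mathsf{gel}_{\mathbf{r}}(M,N,P)$, eliminator $\mathsf{ungel}$, $\beta,\eta$), an $\mathsf{extent}$ operator (case analysis on a bridge dimension), and $\mathcal{U}$ is closed under these. The type $\mathsf{bool}$ has elements $\mathsf{true},\mathsf{false}$ and a dependent eliminator $\mathsf{if}$ with the usual computation rules, and is assumed to satisfy the exact $\eta$-rule $b=\mathsf{if}_{\_.\mathsf{bool}}(b;\mathsf{true};\mathsf{false})$ for a variable $b:\mathsf{bool}$. For $P:\mathsf{Path}_A(M,N)$, $\mathsf{loosen}_A(P):=\mathsf{coe}^{0\to1}_{z.\mathsf{Bridge}_A(P@0,P@z)}(\lambda^{\_}.P@0)$;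 $A$ is bridge-discrete when $\Pi_{a,a':A}\mathsf{isEquiv}(\lambda p.\mathsf{loosen}_A(p):\mathsf{Path}_A(a,a')\to\mathsf{Bridge}_A(a,a'))$ is inhabited. *)

theory Defs
  imports Main
begin

section \<open>Raw syntax\<close>

text \<open>
  De Bruijn syntax with one index space for the three sorts of variables (path dimensions, bridge
  dimensions, term variables); the context says of which sort a variable is.  Dimension
  terms are raw terms as well, so a single substitution function serves all three sorts.

  Binding: \<open>PathT A\<close>, \<open>PLam\<close> and \<open>Coe A\<close> bind a path dimension; \<open>BridgeT A\<close>, \<open>BLam\<close> and \<open>Ungel\<close> bind a
  bridge dimension; in \<open>PiT A B\<close>, \<open>SigT A B\<close>, \<open>Lam M\<close> and the motive of \<open>If\<close> one term variable is
  bound; \<open>R\<close> in \<open>GelT r A B R\<close> binds \<open>a\<close> (index 1) and \<open>b\<close> (index 0).  In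
  \<open>Extent r M N0 N1 N\<close> the branches \<open>N0\<close>, \<open>N1\<close> bind one term variable and \<open>N\<close> binds \<open>a0, a1, c\<close>
  (indices 2, 1, 0).  \<open>HCom r s A M ts\<close> is homogeneous composition from \<open>r\<close> to \<open>s\<close> in \<open>A\<close> with cap \<open>M\<close>;
  an entry \<open>(u, v, N)\<close> of \<open>ts\<close> is a tube face on the constraint \<open>u = v\<close>, where \<open>N\<close> binds a path
  dimension and \<open>u, v\<close> lie outside that binder.
\<close>

datatype tm =
    Var nat
  | I0 | I1  \<comment> \<open>path endpoints\<close>
  | B0 | B1  \<comment> \<open>bridge endpoints\<close>
  | UnivT
  | PiT tm tm | Lam tm | App tm tm
  | SigT tm tm | Pr tm tm | Fst tm | Snd tm
  | BoolT | TT | FF | If tm tm tm tm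
  | PathT tm tm tm | PLam tm | PApp tm tm
  | Coe tm tm tm tm
  | HCom tm tm tm tm "(tm \<times> tm \<times> tm) list"
  | UA
  | BridgeT tm tm tm | BLam tm | BApp tm tm
  | GelT tm tm tm tm | Gel tm tm tm tm | Ungel tm
  | Extent tm tm tm tm tm

lemma tube_size [termination_simp]:
  fixes ts :: "(tm \<times> tm \<times> tm) list" and a b c d :: nat
  defines "S \<equiv> size_list (\<lambda>x. Suc (size (fst x) + Suc (size (fst (snd x)) + size (snd (snd x))))) ts"
  assumes "(u, v, N) \<in> set ts"
  shows "size u < Suc (S + a + b + c + d)"
    and "size v < Suc (S + a + b + c + d)"
    and "size N < Suc (S + a + b + c + d)"
proof -
  have "Suc (size u + Suc (size v + size N)) \<le> S"
    using assms(2) unfolding S_def by (intro size_list_estimation') auto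
  then show "size u < Suc (S + a + b + c + d)"
    and "size v < Suc (S + a + b + c + d)"
    and "size N < Suc (S + a + b + c + d)"
    by simp_all
qed

fun scons :: "'a \<Rightarrow> (nat \<Rightarrow> 'a) \<Rightarrow> nat \<Rightarrow> 'a" (infixr "##" 65) where
  "(t ## f) 0 = t"
| "(t ## f) (Suc n) = f n"

definition lft :: "(nat \<Rightarrow> nat) \<Rightarrow> nat \<Rightarrow> nat" where
  "lft f = 0 ## (\<lambda>n. Suc (f n))"

fun ren :: "(nat \<Rightarrow> nat) \<Rightarrow> tm \<Rightarrow> tm" where
  "ren f (Var n) = Var (f n)"
| "ren f I0 = I0"
| "ren f I1 = I1"
| "ren f B0 = B0"
| "ren f B1 = B1"
| "ren f UnivT = UnivT"
| "ren f (PiT A B) = PiT (ren f A) (ren (lft f) B)"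
| "ren f (Lam M) = Lam (ren (lft f) M)"
| "ren f (App M N) = App (ren f M) (ren f N)"
| "ren f (SigT A B) = SigT (ren f A) (ren (lft f) B)"
| "ren f (Pr M N) = Pr (ren f M) (ren f N)"
| "ren f (Fst M) = Fst (ren f M)"
| "ren f (Snd M) = Snd (ren f M)"
| "ren f BoolT = BoolT"
| "ren f TT = TT"
| "ren f FF = FF"
| "ren f (If C M N0 N1) = If (ren (lft f) C) (ren f M) (ren f N0) (ren f N1)"
| "ren f (PathT A M N) = PathT (ren (lft f) A) (ren f M) (ren f N)"
| "ren f (PLam M) = PLam (ren (lft f) M)"
| "ren f (PApp M r) = PApp (ren f M) (ren f r)"
| "ren f (Coe A r s M) = Coe (ren (lft f) A) (ren f r) (ren f s) (ren f M)"
| "ren f (HCom r s A M ts) = HCom (ren f r) (ren f s) (ren f A) (ren f M)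
     (map (\<lambda>(u, v, N). (ren f u, ren f v, ren (lft f) N)) ts)"
| "ren f UA = UA"
| "ren f (BridgeT A M N) = BridgeT (ren (lft f) A) (ren f M) (ren f N)"
| "ren f (BLam M) = BLam (ren (lft f) M)"
| "ren f (BApp M r) = BApp (ren f M) (ren f r)"
| "ren f (GelT r A B R) = GelT (ren f r) (ren f A) (ren f B) (ren (lft (lft f)) R)"
| "ren f (Gel r M N P) = Gel (ren f r) (ren f M) (ren f N) (ren f P)"
| "ren f (Ungel Q) = Ungel (ren (lft f) Q)"
| "ren f (Extent r M N0 N1 N) = Extent (ren f r) (ren f M) (ren (lft f) N0) (ren (lft f) N1)
     (ren (lft (lft (lft f))) N)"

definition wk :: "nat \<Rightarrow> tm \<Rightarrow> tm" where
  "wk k = ren (\<lambda>n. n + k)"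

definition up :: "(nat \<Rightarrow> tm) \<Rightarrow> nat \<Rightarrow> tm" where
  "up \<sigma> = Var 0 ## (\<lambda>n. wk 1 (\<sigma> n))"

fun subst :: "(nat \<Rightarrow> tm) \<Rightarrow> tm \<Rightarrow> tm" where
  "subst \<sigma> (Var n) = \<sigma> n"
| "subst \<sigma> I0 = I0"
| "subst \<sigma> I1 = I1"
| "subst \<sigma> B0 = B0"
| "subst \<sigma> B1 = B1"
| "subst \<sigma> UnivT = UnivT"
| "subst \<sigma> (PiT A B) = PiT (subst \<sigma> A) (subst (up \<sigma>) B)"
| "subst \<sigma> (Lam M) = Lam (subst (up \<sigma>) M)"
| "subst \<sigma> (App M N) = App (subst \<sigma> M) (subst \<sigma> N)"
| "subst \<sigma> (SigT A B) = SigT (subst \<sigma> A) (subst (up \<sigma>) B)"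
| "subst \<sigma> (Pr M N) = Pr (subst \<sigma> M) (subst \<sigma> N)"
| "subst \<sigma> (Fst M) = Fst (subst \<sigma> M)"
| "subst \<sigma> (Snd M) = Snd (subst \<sigma> M)"
| "subst \<sigma> BoolT = BoolT"
| "subst \<sigma> TT = TT"
| "subst \<sigma> FF = FF"
| "subst \<sigma> (If C M N0 N1) = If (subst (up \<sigma>) C) (subst \<sigma> M) (subst \<sigma> N0) (subst \<sigma> N1)"
| "subst \<sigma> (PathT A M N) = PathT (subst (up \<sigma>) A) (subst \<sigma> M) (subst \<sigma> N)"
| "subst \<sigma> (PLam M) = PLam (subst (up \<sigma>) M)"
| "subst \<sigma> (PApp M r) = PApp (subst \<sigma> M) (subst \<sigma> r)"
| "subst \<sigma> (Coe A r s M) = Coe (subst (up \<sigma>) A) (subst \<sigma> r) (subst \<sigma> s) (subst \<sigma> M)"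
| "subst \<sigma> (HCom r s A M ts) = HCom (subst \<sigma> r) (subst \<sigma> s) (subst \<sigma> A) (subst \<sigma> M)
     (map (\<lambda>(u, v, N). (subst \<sigma> u, subst \<sigma> v, subst (up \<sigma>) N)) ts)"
| "subst \<sigma> UA = UA"
| "subst \<sigma> (BridgeT A M N) = BridgeT (subst (up \<sigma>) A) (subst \<sigma> M) (subst \<sigma> N)"
| "subst \<sigma> (BLam M) = BLam (subst (up \<sigma>) M)"
| "subst \<sigma> (BApp M r) = BApp (subst \<sigma> M) (subst \<sigma> r)"
| "subst \<sigma> (GelT r A B R) = GelT (subst \<sigma> r) (subst \<sigma> A) (subst \<sigma> B) (subst (up (up \<sigma>)) R)"
| "subst \<sigma> (Gel r M N P) = Gel (subst \<sigma> r) (subst \<sigma> M) (subst \<sigma> N) (subst \<sigma> P)"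
| "subst \<sigma> (Ungel Q) = Ungel (subst (up \<sigma>) Q)"
| "subst \<sigma> (Extent r M N0 N1 N) = Extent (subst \<sigma> r) (subst \<sigma> M) (subst (up \<sigma>) N0) (subst (up \<sigma>) N1)
     (subst (up (up (up \<sigma>))) N)"

text \<open>\<open>sub1 N M\<close> replaces index 0 of \<open>M\<close> by \<open>N\<close>; \<open>sub2 N1 N0 M\<close> replaces index 1 by \<open>N1\<close> and index 0
  by \<open>N0\<close>; similarly \<open>sub3\<close>.  All arguments \<open>N\<close> live in the context without the replaced variables.\<close>

definition sub1 :: "tm \<Rightarrow> tm \<Rightarrow> tm" where
  "sub1 N = subst (N ## Var)"

definition sub2 :: "tm \<Rightarrow> tm \<Rightarrow> tm \<Rightarrow> tm" where
  "sub2 N1 N0 = subst (N0 ## N1 ## Var)"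

definition sub3 :: "tm \<Rightarrow> tm \<Rightarrow> tm \<Rightarrow> tm \<Rightarrow> tm" where
  "sub3 N2 N1 N0 = subst (N0 ## N1 ## N2 ## Var)"


section \<open>Equivalences, loosening and bridge-discreteness\<close>

definition arr :: "tm \<Rightarrow> tm \<Rightarrow> tm" where
  "arr A B = PiT A (wk 1 B)"

text \<open>\<open>isEquiv A B F\<close> is
  \<open>(\<Sigma>g:B\<rightarrow>A. \<Pi>b:B. Path\<^sub>B(F(g b), b)) \<times> (\<Sigma>h:B\<rightarrow>A. \<Pi>a:A. Path\<^sub>A(h(F a), a))\<close>,
  the \<open>isequiv\<close> of homotopy type theory.\<close>

definition hasSection :: "tm \<Rightarrow> tm \<Rightarrow> tm \<Rightarrow> tm" where
  "hasSection A B F =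
     SigT (arr B A) (PiT (wk 1 B)
       (PathT (wk 3 B) (App (wk 2 F) (App (Var 1) (Var 0))) (Var 0)))"

definition hasRetraction :: "tm \<Rightarrow> tm \<Rightarrow> tm \<Rightarrow> tm" where
  "hasRetraction A B F =
     SigT (arr B A) (PiT (wk 1 A)
       (PathT (wk 3 A) (App (Var 1) (App (wk 2 F) (Var 0))) (Var 0)))"

definition isEquiv :: "tm \<Rightarrow> tm \<Rightarrow> tm \<Rightarrow> tm" where
  "isEquiv A B F = SigT (hasSection A B F) (wk 1 (hasRetraction A B F))"

definition Equiv :: "tm \<Rightarrow> tm \<Rightarrow> tm" where
  "Equiv A B = SigT (arr A B) (isEquiv (wk 1 A) (wk 1 B) (Var 0))"

definition idEquiv :: tm where
  "idEquiv = Pr (Lam (Var 0))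
     (Pr (Pr (Lam (Var 0)) (Lam (PLam (Var 1)))) (Pr (Lam (Var 0)) (Lam (PLam (Var 1)))))"

text \<open>Univalence: for \<open>A, B : U\<close>, transport of the identity equivalence,
  \<open>\<lambda>p. coe[0\<rightarrow>1, z. Equiv A (p@z)] idEquiv : Path\<^sub>U(A, B) \<rightarrow> Equiv A B\<close>, is an equivalence.\<close>

definition univalence :: tm where
  "univalence = PiT UnivT (PiT UnivT
     (isEquiv (PathT UnivT (Var 1) (Var 0)) (Equiv (Var 1) (Var 0))
       (Lam (Coe (Equiv (Var 3) (PApp (Var 1) (Var 0))) I0 I1 idEquiv))))"

definition loosen :: "tm \<Rightarrow> tm \<Rightarrow> tm" where
  "loosen A P =
     Coe (BridgeT (wk 2 A) (PApp (wk 1 P) I0) (PApp (wk 1 P) (Var 0))) I0 I1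
       (BLam (wk 1 (PApp P I0)))"

definition bridgeDiscrete :: "tm \<Rightarrow> tm" where
  "bridgeDiscrete A = PiT A (PiT (wk 1 A)
     (isEquiv (PathT (wk 3 A) (Var 1) (Var 0)) (BridgeT (wk 3 A) (Var 1) (Var 0))
       (Lam (loosen (wk 3 A) (Var 0)))))"


section \<open>Contexts and dimensions\<close>

text \<open>
  A context is a telescope of entries (most recent first; the type in entry \<open>i\<close> is
  relative to the entries after it) together with a list of dimension constraints (relative to the
  whole telescope).  \<open>Gone\<close> marks a variable that has been removed by a restriction but still
  occupies its index.
\<close>

datatype entry = TmV tm | PathV | BridgeV | Gone

type_synonym ctx = "entry list \<times> (tm \<times> tm) list"

definition ext :: "ctx \<Rightarrow> entry \<Rightarrow> ctx" (infixl "\<triangleright>" 60) where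
  "\<Gamma> \<triangleright> e = (e # fst \<Gamma>, map (\<lambda>(u, v). (wk 1 u, wk 1 v)) (snd \<Gamma>))"

definition assm :: "ctx \<Rightarrow> tm \<times> tm \<Rightarrow> ctx" (infixl "\<triangleright>\<triangleright>" 60) where
  "\<Gamma> \<triangleright>\<triangleright> \<xi> = (fst \<Gamma>, \<xi> # snd \<Gamma>)"

definition entry_is :: "ctx \<Rightarrow> nat \<Rightarrow> entry \<Rightarrow> bool" where
  "entry_is \<Gamma> i e \<longleftrightarrow> i < length (fst \<Gamma>) \<and> fst \<Gamma> ! i = e"

text \<open>
  Substructurality of bridge dimensions: a term applied to \<open>r\<close> has to live in the restriction of
  the context by \<open>r\<close>.  Restriction by a bridge variable removes that variable, the constraints
  mentioning it, and all term variables declared after it (these may later be replaced by terms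
  mentioning it); other dimensions stay.  Restriction by an endpoint removes nothing.
\<close>

definition restr :: "ctx \<Rightarrow> tm \<Rightarrow> ctx" (infixl "\<setminus>" 60) where
  "\<Gamma> \<setminus> r = (case r of
      Var i \<Rightarrow>
        (map (\<lambda>j. if j = i \<or> (j < i \<and> (\<exists>A. fst \<Gamma> ! j = TmV A)) then Gone else fst \<Gamma> ! j)
           [0..<length (fst \<Gamma>)],
         filter (\<lambda>(u, v). u \<noteq> Var i \<and> v \<noteq> Var i) (snd \<Gamma>))
    | _ \<Rightarrow> \<Gamma>)"

definition pdim :: "ctx \<Rightarrow> tm \<Rightarrow> bool" where
  "pdim \<Gamma> r \<longleftrightarrow> r = I0 \<or> r = I1 \<or> (\<exists>i. r = Var i \<and> entry_is \<Gamma> i PathV)"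

definition bdim :: "ctx \<Rightarrow> tm \<Rightarrow> bool" where
  "bdim \<Gamma> r \<longleftrightarrow> r = B0 \<or> r = B1 \<or> (\<exists>i. r = Var i \<and> entry_is \<Gamma> i BridgeV)"

text \<open>Constraints: \<open>r = s\<close> for path dimensions, and \<open>r = \<epsilon>\<close> with \<open>\<epsilon>\<close> an endpoint for bridge dimensions.\<close>

definition constr :: "ctx \<Rightarrow> tm \<times> tm \<Rightarrow> bool" where
  "constr \<Gamma> \<xi> \<longleftrightarrow>
     pdim \<Gamma> (fst \<xi>) \<and> pdim \<Gamma> (snd \<xi>) \<or> bdim \<Gamma> (fst \<xi>) \<and> snd \<xi> \<in> {B0, B1}"

inductive dimeq :: "ctx \<Rightarrow> tm \<Rightarrow> tm \<Rightarrow> bool" for \<Gamma> where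
  dimeq_refl: "pdim \<Gamma> r \<or> bdim \<Gamma> r \<Longrightarrow> dimeq \<Gamma> r r"
| dimeq_assm: "(r, s) \<in> set (snd \<Gamma>) \<Longrightarrow> constr \<Gamma> (r, s) \<Longrightarrow> dimeq \<Gamma> r s"
| dimeq_sym: "dimeq \<Gamma> r s \<Longrightarrow> dimeq \<Gamma> s r"
| dimeq_trans: "dimeq \<Gamma> r s \<Longrightarrow> dimeq \<Gamma> s t \<Longrightarrow> dimeq \<Gamma> r t"

definition inconsistent :: "ctx \<Rightarrow> bool" where
  "inconsistent \<Gamma> \<longleftrightarrow> dimeq \<Gamma> I0 I1 \<or> dimeq \<Gamma> B0 B1"


section \<open>Judgments\<close>

text \<open>
  A single judgment form \<open>\<Gamma> \<turnstile> M \<doteq> N \<Colon> T\<close>: for \<open>T = Ty\<close> it says that \<open>M\<close> and \<open>N\<close> are exactly equal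
  types, for \<open>T = El A\<close> that they are exactly equal elements of \<open>A\<close>.  The judgments "\<open>M\<close> is a type"
  and "\<open>M\<close> is an element of \<open>A\<close>" are the reflexive instances, written \<open>\<Gamma> \<turnstile> M \<Colon> T\<close>, so each typing rule
  is stated together with its congruence rule.  The universe is a la Russell; the classes \<open>Ty\<close> and
  \<open>El UnivT\<close> satisfy \<open>univ\<close>, and formation rules are stated for both at once.

  Every rule that extends the context has a premise making the extension well-formed, so derivations
  from the empty context contain only well-formed contexts.
\<close>

datatype cls = Ty | El tm

definition univ :: "cls \<Rightarrow> bool" where
  "univ S \<longleftrightarrow> S = Ty \<or> S = El UnivT"

inductive judg :: "ctx \<Rightarrow> tm \<Rightarrow> tm \<Rightarrow> cls \<Rightarrow> bool" ("(_ \<turnstile>/ _ \<doteq>/ _ \<Colon>/ _)" [51, 51, 51, 51] 50)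
  and has :: "ctx \<Rightarrow> tm \<Rightarrow> cls \<Rightarrow> bool" ("(_ \<turnstile>/ _ \<Colon>/ _)" [51, 51, 51] 50)
where
  "\<Gamma> \<turnstile> M \<Colon> T \<equiv> \<Gamma> \<turnstile> M \<doteq> M \<Colon> T"

\<comment> \<open>structural rules\<close>
| sym: "\<Gamma> \<turnstile> M \<doteq> N \<Colon> T \<Longrightarrow> \<Gamma> \<turnstile> N \<doteq> M \<Colon> T"
| trans: "\<lbrakk>\<Gamma> \<turnstile> M \<doteq> N \<Colon> T; \<Gamma> \<turnstile> N \<doteq> P \<Colon> T\<rbrakk> \<Longrightarrow> \<Gamma> \<turnstile> M \<doteq> P \<Colon> T"
| conv: "\<lbrakk>\<Gamma> \<turnstile> M \<doteq> N \<Colon> El A; \<Gamma> \<turnstile> A \<doteq> B \<Colon> Ty\<rbrakk> \<Longrightarrow> \<Gamma> \<turnstile> M \<doteq> N \<Colon> El B"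
| var: "entry_is \<Gamma> i (TmV A) \<Longrightarrow> \<Gamma> \<turnstile> Var i \<Colon> El (wk (Suc i) A)"
| absurd: "\<lbrakk>inconsistent \<Gamma>; \<Gamma> \<turnstile> M \<Colon> T; \<Gamma> \<turnstile> N \<Colon> T\<rbrakk> \<Longrightarrow> \<Gamma> \<turnstile> M \<doteq> N \<Colon> T"

\<comment> \<open>universe\<close>
| univ_form: "\<Gamma> \<turnstile> UnivT \<Colon> Ty"
| univ_el: "\<Gamma> \<turnstile> A \<doteq> B \<Colon> El UnivT \<Longrightarrow> \<Gamma> \<turnstile> A \<doteq> B \<Colon> Ty"
| univ_ua: "\<Gamma> \<turnstile> UA \<Colon> El univalence"

\<comment> \<open>dependent functions\<close>
| pi_form: "\<lbrakk>univ S; \<Gamma> \<turnstile> A \<doteq> A' \<Colon> S; \<Gamma> \<triangleright> TmV A \<turnstile> B \<doteq> B' \<Colon> S\<rbrakk> \<Longrightarrow> \<Gamma> \<turnstile> PiT A B \<doteq> PiT A' B' \<Colon> S"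
| pi_lam: "\<lbrakk>\<Gamma> \<turnstile> A \<Colon> Ty; \<Gamma> \<triangleright> TmV A \<turnstile> M \<doteq> M' \<Colon> El B\<rbrakk> \<Longrightarrow> \<Gamma> \<turnstile> Lam M \<doteq> Lam M' \<Colon> El (PiT A B)"
| pi_app: "\<lbrakk>\<Gamma> \<turnstile> M \<doteq> M' \<Colon> El (PiT A B); \<Gamma> \<turnstile> N \<doteq> N' \<Colon> El A\<rbrakk> \<Longrightarrow>
    \<Gamma> \<turnstile> App M N \<doteq> App M' N' \<Colon> El (sub1 N B)"
| pi_beta: "\<lbrakk>\<Gamma> \<turnstile> A \<Colon> Ty; \<Gamma> \<triangleright> TmV A \<turnstile> M \<Colon> El B; \<Gamma> \<turnstile> N \<Colon> El A\<rbrakk> \<Longrightarrow>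
    \<Gamma> \<turnstile> App (Lam M) N \<doteq> sub1 N M \<Colon> El (sub1 N B)"
| pi_eta: "\<Gamma> \<turnstile> M \<Colon> El (PiT A B) \<Longrightarrow> \<Gamma> \<turnstile> M \<doteq> Lam (App (wk 1 M) (Var 0)) \<Colon> El (PiT A B)"

\<comment> \<open>dependent pairs\<close>
| sig_form: "\<lbrakk>univ S; \<Gamma> \<turnstile> A \<doteq> A' \<Colon> S; \<Gamma> \<triangleright> TmV A \<turnstile> B \<doteq> B' \<Colon> S\<rbrakk> \<Longrightarrow>
    \<Gamma> \<turnstile> SigT A B \<doteq> SigT A' B' \<Colon> S"
| sig_pair: "\<lbrakk>\<Gamma> \<turnstile> M \<doteq> M' \<Colon> El A; \<Gamma> \<triangleright> TmV A \<turnstile> B \<Colon> Ty; \<Gamma> \<turnstile> N \<doteq> N' \<Colon> El (sub1 M B)\<rbrakk> \<Longrightarrow>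
    \<Gamma> \<turnstile> Pr M N \<doteq> Pr M' N' \<Colon> El (SigT A B)"
| sig_fst: "\<Gamma> \<turnstile> M \<doteq> M' \<Colon> El (SigT A B) \<Longrightarrow> \<Gamma> \<turnstile> Fst M \<doteq> Fst M' \<Colon> El A"
| sig_snd: "\<Gamma> \<turnstile> M \<doteq> M' \<Colon> El (SigT A B) \<Longrightarrow> \<Gamma> \<turnstile> Snd M \<doteq> Snd M' \<Colon> El (sub1 (Fst M) B)"
| sig_beta1: "\<lbrakk>\<Gamma> \<turnstile> M \<Colon> El A; \<Gamma> \<triangleright> TmV A \<turnstile> B \<Colon> Ty; \<Gamma> \<turnstile> N \<Colon> El (sub1 M B)\<rbrakk> \<Longrightarrow>
    \<Gamma> \<turnstile> Fst (Pr M N) \<doteq> M \<Colon> El A"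
| sig_beta2: "\<lbrakk>\<Gamma> \<turnstile> M \<Colon> El A; \<Gamma> \<triangleright> TmV A \<turnstile> B \<Colon> Ty; \<Gamma> \<turnstile> N \<Colon> El (sub1 M B)\<rbrakk> \<Longrightarrow>
    \<Gamma> \<turnstile> Snd (Pr M N) \<doteq> N \<Colon> El (sub1 M B)"
| sig_eta: "\<Gamma> \<turnstile> M \<Colon> El (SigT A B) \<Longrightarrow> \<Gamma> \<turnstile> M \<doteq> Pr (Fst M) (Snd M) \<Colon> El (SigT A B)"

\<comment> \<open>booleans, with the exact eta-rule for variables\<close>
| bool_form: "univ S \<Longrightarrow> \<Gamma> \<turnstile> BoolT \<Colon> S"
| bool_true: "\<Gamma> \<turnstile> TT \<Colon> El BoolT"
| bool_false: "\<Gamma> \<turnstile> FF \<Colon> El BoolT"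
| bool_if: "\<lbrakk>\<Gamma> \<triangleright> TmV BoolT \<turnstile> C \<doteq> C' \<Colon> Ty; \<Gamma> \<turnstile> M \<doteq> M' \<Colon> El BoolT;
    \<Gamma> \<turnstile> N0 \<doteq> N0' \<Colon> El (sub1 TT C); \<Gamma> \<turnstile> N1 \<doteq> N1' \<Colon> El (sub1 FF C)\<rbrakk> \<Longrightarrow>
    \<Gamma> \<turnstile> If C M N0 N1 \<doteq> If C' M' N0' N1' \<Colon> El (sub1 M C)"
| bool_beta_true: "\<lbrakk>\<Gamma> \<triangleright> TmV BoolT \<turnstile> C \<Colon> Ty; \<Gamma> \<turnstile> N0 \<Colon> El (sub1 TT C); \<Gamma> \<turnstile> N1 \<Colon> El (sub1 FF C)\<rbrakk> \<Longrightarrow>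
    \<Gamma> \<turnstile> If C TT N0 N1 \<doteq> N0 \<Colon> El (sub1 TT C)"
| bool_beta_false: "\<lbrakk>\<Gamma> \<triangleright> TmV BoolT \<turnstile> C \<Colon> Ty; \<Gamma> \<turnstile> N0 \<Colon> El (sub1 TT C); \<Gamma> \<turnstile> N1 \<Colon> El (sub1 FF C)\<rbrakk> \<Longrightarrow>
    \<Gamma> \<turnstile> If C FF N0 N1 \<doteq> N1 \<Colon> El (sub1 FF C)"
| bool_eta: "\<Gamma> \<turnstile> Var i \<Colon> El BoolT \<Longrightarrow> \<Gamma> \<turnstile> Var i \<doteq> If BoolT (Var i) TT FF \<Colon> El BoolT"

\<comment> \<open>path types\<close>
| path_form: "\<lbrakk>univ S; \<Gamma> \<triangleright> PathV \<turnstile> A \<doteq> A' \<Colon> S;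
    \<Gamma> \<turnstile> M \<doteq> M' \<Colon> El (sub1 I0 A); \<Gamma> \<turnstile> N \<doteq> N' \<Colon> El (sub1 I1 A)\<rbrakk> \<Longrightarrow>
    \<Gamma> \<turnstile> PathT A M N \<doteq> PathT A' M' N' \<Colon> S"
| path_lam: "\<Gamma> \<triangleright> PathV \<turnstile> M \<doteq> M' \<Colon> El A \<Longrightarrow>
    \<Gamma> \<turnstile> PLam M \<doteq> PLam M' \<Colon> El (PathT A (sub1 I0 M) (sub1 I1 M))"
| path_app: "\<lbrakk>\<Gamma> \<turnstile> M \<doteq> M' \<Colon> El (PathT A N0 N1); pdim \<Gamma> r; pdim \<Gamma> r'; dimeq \<Gamma> r r'\<rbrakk> \<Longrightarrow>
    \<Gamma> \<turnstile> PApp M r \<doteq> PApp M' r' \<Colon> El (sub1 r A)"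
| path_app0: "\<Gamma> \<turnstile> M \<Colon> El (PathT A N0 N1) \<Longrightarrow> \<Gamma> \<turnstile> PApp M I0 \<doteq> N0 \<Colon> El (sub1 I0 A)"
| path_app1: "\<Gamma> \<turnstile> M \<Colon> El (PathT A N0 N1) \<Longrightarrow> \<Gamma> \<turnstile> PApp M I1 \<doteq> N1 \<Colon> El (sub1 I1 A)"
| path_beta: "\<lbrakk>\<Gamma> \<triangleright> PathV \<turnstile> M \<Colon> El A; pdim \<Gamma> r\<rbrakk> \<Longrightarrow>
    \<Gamma> \<turnstile> PApp (PLam M) r \<doteq> sub1 r M \<Colon> El (sub1 r A)"
| path_eta: "\<Gamma> \<turnstile> M \<Colon> El (PathT A N0 N1) \<Longrightarrow>
    \<Gamma> \<turnstile> M \<doteq> PLam (PApp (wk 1 M) (Var 0)) \<Colon> El (PathT A N0 N1)"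

\<comment> \<open>Kan operations: every type has coercion and homogeneous composition, specified by their typing
  and boundary equations; nothing is assumed on how they compute at particular types\<close>
| coe: "\<lbrakk>\<Gamma> \<triangleright> PathV \<turnstile> A \<doteq> A' \<Colon> Ty; \<Gamma> \<turnstile> M \<doteq> M' \<Colon> El (sub1 r A);
    pdim \<Gamma> r; pdim \<Gamma> r'; dimeq \<Gamma> r r'; pdim \<Gamma> s; pdim \<Gamma> s'; dimeq \<Gamma> s s'\<rbrakk> \<Longrightarrow>
    \<Gamma> \<turnstile> Coe A r s M \<doteq> Coe A' r' s' M' \<Colon> El (sub1 s A)"
| coe_id: "\<lbrakk>\<Gamma> \<triangleright> PathV \<turnstile> A \<Colon> Ty; \<Gamma> \<turnstile> M \<Colon> El (sub1 r A); pdim \<Gamma> r\<rbrakk> \<Longrightarrow>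
    \<Gamma> \<turnstile> Coe A r r M \<doteq> M \<Colon> El (sub1 r A)"
| hcom: "\<lbrakk>pdim \<Gamma> r; pdim \<Gamma> r'; dimeq \<Gamma> r r'; pdim \<Gamma> s; pdim \<Gamma> s'; dimeq \<Gamma> s s';
    \<Gamma> \<turnstile> A \<doteq> A' \<Colon> Ty; \<Gamma> \<turnstile> M \<doteq> M' \<Colon> El A; length ts = length ts';
    \<And>i u v N u' v' N'. \<lbrakk>i < length ts; ts ! i = (u, v, N); ts' ! i = (u', v', N')\<rbrakk> \<Longrightarrow>
      constr \<Gamma> (u, v) \<and> constr \<Gamma> (u', v') \<and> dimeq \<Gamma> u u' \<and> dimeq \<Gamma> v v' \<and>
      \<Gamma> \<triangleright>\<triangleright> (u, v) \<triangleright> PathV \<turnstile> N \<doteq> N' \<Colon> El (wk 1 A) \<and>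
      \<Gamma> \<triangleright>\<triangleright> (u, v) \<turnstile> sub1 r N \<doteq> M \<Colon> El A;
    \<And>i j u v N u' v' N'. \<lbrakk>i < length ts; j < length ts; ts ! i = (u, v, N); ts ! j = (u', v', N')\<rbrakk> \<Longrightarrow>
      \<Gamma> \<triangleright>\<triangleright> (u, v) \<triangleright>\<triangleright> (u', v') \<triangleright> PathV \<turnstile> N \<doteq> N' \<Colon> El (wk 1 A)\<rbrakk> \<Longrightarrow>
    \<Gamma> \<turnstile> HCom r s A M ts \<doteq> HCom r' s' A' M' ts' \<Colon> El A"
| hcom_cap: "\<Gamma> \<turnstile> HCom r r A M ts \<Colon> El A \<Longrightarrow> \<Gamma> \<turnstile> HCom r r A M ts \<doteq> M \<Colon> El A"
| hcom_tube: "\<lbrakk>\<Gamma> \<turnstile> HCom r s A M ts \<Colon> El A; (u, v, N) \<in> set ts; dimeq \<Gamma> u v\<rbrakk> \<Longrightarrow>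
    \<Gamma> \<turnstile> HCom r s A M ts \<doteq> sub1 s N \<Colon> El A"

\<comment> \<open>bridge types\<close>
| bridge_form: "\<lbrakk>univ S; \<Gamma> \<triangleright> BridgeV \<turnstile> A \<doteq> A' \<Colon> S;
    \<Gamma> \<turnstile> M \<doteq> M' \<Colon> El (sub1 B0 A); \<Gamma> \<turnstile> N \<doteq> N' \<Colon> El (sub1 B1 A)\<rbrakk> \<Longrightarrow>
    \<Gamma> \<turnstile> BridgeT A M N \<doteq> BridgeT A' M' N' \<Colon> S"
| bridge_lam: "\<Gamma> \<triangleright> BridgeV \<turnstile> M \<doteq> M' \<Colon> El A \<Longrightarrow>
    \<Gamma> \<turnstile> BLam M \<doteq> BLam M' \<Colon> El (BridgeT A (sub1 B0 M) (sub1 B1 M))"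
| bridge_app: "\<lbrakk>bdim \<Gamma> r; \<Gamma> \<setminus> r \<turnstile> M \<doteq> M' \<Colon> El (BridgeT A N0 N1)\<rbrakk> \<Longrightarrow>
    \<Gamma> \<turnstile> BApp M r \<doteq> BApp M' r \<Colon> El (sub1 r A)"
| bridge_app0: "\<lbrakk>bdim \<Gamma> r; dimeq \<Gamma> r B0; \<Gamma> \<setminus> r \<turnstile> M \<Colon> El (BridgeT A N0 N1)\<rbrakk> \<Longrightarrow>
    \<Gamma> \<turnstile> BApp M r \<doteq> N0 \<Colon> El (sub1 r A)"
| bridge_app1: "\<lbrakk>bdim \<Gamma> r; dimeq \<Gamma> r B1; \<Gamma> \<setminus> r \<turnstile> M \<Colon> El (BridgeT A N0 N1)\<rbrakk> \<Longrightarrow>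
    \<Gamma> \<turnstile> BApp M r \<doteq> N1 \<Colon> El (sub1 r A)"
| bridge_beta: "\<lbrakk>bdim \<Gamma> r; \<Gamma> \<setminus> r \<triangleright> BridgeV \<turnstile> M \<Colon> El A\<rbrakk> \<Longrightarrow>
    \<Gamma> \<turnstile> BApp (BLam M) r \<doteq> sub1 r M \<Colon> El (sub1 r A)"
| bridge_eta: "\<Gamma> \<turnstile> M \<Colon> El (BridgeT A N0 N1) \<Longrightarrow>
    \<Gamma> \<turnstile> M \<doteq> BLam (BApp (wk 1 M) (Var 0)) \<Colon> El (BridgeT A N0 N1)"

\<comment> \<open>Gel-types\<close>
| gel_form: "\<lbrakk>univ S; bdim \<Gamma> r; \<Gamma> \<setminus> r \<turnstile> A \<doteq> A' \<Colon> S; \<Gamma> \<setminus> r \<turnstile> B \<doteq> B' \<Colon> S;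
    \<Gamma> \<setminus> r \<triangleright> TmV A \<triangleright> TmV (wk 1 B) \<turnstile> R \<doteq> R' \<Colon> S\<rbrakk> \<Longrightarrow>
    \<Gamma> \<turnstile> GelT r A B R \<doteq> GelT r A' B' R' \<Colon> S"
| gel_form0: "\<lbrakk>univ S; bdim \<Gamma> r; dimeq \<Gamma> r B0; \<Gamma> \<setminus> r \<turnstile> A \<Colon> S; \<Gamma> \<setminus> r \<turnstile> B \<Colon> S;
    \<Gamma> \<setminus> r \<triangleright> TmV A \<triangleright> TmV (wk 1 B) \<turnstile> R \<Colon> S\<rbrakk> \<Longrightarrow>
    \<Gamma> \<turnstile> GelT r A B R \<doteq> A \<Colon> S"
| gel_form1: "\<lbrakk>univ S; bdim \<Gamma> r; dimeq \<Gamma> r B1; \<Gamma> \<setminus> r \<turnstile> A \<Colon> S; \<Gamma> \<setminus> r \<turnstile> B \<Colon> S;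
    \<Gamma> \<setminus> r \<triangleright> TmV A \<triangleright> TmV (wk 1 B) \<turnstile> R \<Colon> S\<rbrakk> \<Longrightarrow>
    \<Gamma> \<turnstile> GelT r A B R \<doteq> B \<Colon> S"
| gel_intro: "\<lbrakk>bdim \<Gamma> r; \<Gamma> \<setminus> r \<triangleright> TmV A \<triangleright> TmV (wk 1 B) \<turnstile> R \<Colon> Ty;
    \<Gamma> \<setminus> r \<turnstile> M \<doteq> M' \<Colon> El A; \<Gamma> \<setminus> r \<turnstile> N \<doteq> N' \<Colon> El B; \<Gamma> \<setminus> r \<turnstile> P \<doteq> P' \<Colon> El (sub2 M N R)\<rbrakk> \<Longrightarrow>
    \<Gamma> \<turnstile> Gel r M N P \<doteq> Gel r M' N' P' \<Colon> El (GelT r A B R)"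
| gel_intro0: "\<lbrakk>bdim \<Gamma> r; dimeq \<Gamma> r B0; \<Gamma> \<setminus> r \<triangleright> TmV A \<triangleright> TmV (wk 1 B) \<turnstile> R \<Colon> Ty;
    \<Gamma> \<setminus> r \<turnstile> M \<Colon> El A; \<Gamma> \<setminus> r \<turnstile> N \<Colon> El B; \<Gamma> \<setminus> r \<turnstile> P \<Colon> El (sub2 M N R)\<rbrakk> \<Longrightarrow>
    \<Gamma> \<turnstile> Gel r M N P \<doteq> M \<Colon> El A"
| gel_intro1: "\<lbrakk>bdim \<Gamma> r; dimeq \<Gamma> r B1; \<Gamma> \<setminus> r \<triangleright> TmV A \<triangleright> TmV (wk 1 B) \<turnstile> R \<Colon> Ty;
    \<Gamma> \<setminus> r \<turnstile> M \<Colon> El A; \<Gamma> \<setminus> r \<turnstile> N \<Colon> El B; \<Gamma> \<setminus> r \<turnstile> P \<Colon> El (sub2 M N R)\<rbrakk> \<Longrightarrow>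
    \<Gamma> \<turnstile> Gel r M N P \<doteq> N \<Colon> El B"
| gel_elim: "\<lbrakk>\<Gamma> \<turnstile> A \<Colon> Ty; \<Gamma> \<turnstile> B \<Colon> Ty; \<Gamma> \<triangleright> TmV A \<triangleright> TmV (wk 1 B) \<turnstile> R \<Colon> Ty;
    \<Gamma> \<triangleright> BridgeV \<turnstile> Q \<doteq> Q' \<Colon> El (GelT (Var 0) (wk 1 A) (wk 1 B) (ren (lft (lft Suc)) R))\<rbrakk> \<Longrightarrow>
    \<Gamma> \<turnstile> Ungel Q \<doteq> Ungel Q' \<Colon> El (sub2 (sub1 B0 Q) (sub1 B1 Q) R)"
| gel_beta: "\<lbrakk>\<Gamma> \<triangleright> TmV A \<triangleright> TmV (wk 1 B) \<turnstile> R \<Colon> Ty;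
    \<Gamma> \<turnstile> M \<Colon> El A; \<Gamma> \<turnstile> N \<Colon> El B; \<Gamma> \<turnstile> P \<Colon> El (sub2 M N R)\<rbrakk> \<Longrightarrow>
    \<Gamma> \<turnstile> Ungel (Gel (Var 0) (wk 1 M) (wk 1 N) (wk 1 P)) \<doteq> P \<Colon> El (sub2 M N R)"
| gel_eta: "\<lbrakk>bdim \<Gamma> r; \<Gamma> \<setminus> r \<turnstile> A \<Colon> Ty; \<Gamma> \<setminus> r \<turnstile> B \<Colon> Ty;
    \<Gamma> \<setminus> r \<triangleright> TmV A \<triangleright> TmV (wk 1 B) \<turnstile> R \<Colon> Ty;
    \<Gamma> \<setminus> r \<triangleright> BridgeV \<turnstile> Q \<Colon> El (GelT (Var 0) (wk 1 A) (wk 1 B) (ren (lft (lft Suc)) R))\<rbrakk> \<Longrightarrow>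
    \<Gamma> \<turnstile> sub1 r Q \<doteq> Gel r (sub1 B0 Q) (sub1 B1 Q) (Ungel Q) \<Colon> El (GelT r A B R)"

\<comment> \<open>extent: in the last premise the context is \<open>a0, a1, c\<close> and the type is
  \<open>Bridge[x. B(x, c@x)] (N0(a0), N1(a1))\<close>\<close>
| extent: "\<lbrakk>bdim \<Gamma> r; \<Gamma> \<setminus> r \<triangleright> BridgeV \<turnstile> A \<Colon> Ty; \<Gamma> \<setminus> r \<triangleright> BridgeV \<triangleright> TmV A \<turnstile> B \<Colon> Ty;
    \<Gamma> \<turnstile> M \<doteq> M' \<Colon> El (sub1 r A);
    \<Gamma> \<setminus> r \<triangleright> TmV (sub1 B0 A) \<turnstile> N0 \<doteq> N0' \<Colon> El (subst (up (B0 ## Var)) B);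
    \<Gamma> \<setminus> r \<triangleright> TmV (sub1 B1 A) \<turnstile> N1 \<doteq> N1' \<Colon> El (subst (up (B1 ## Var)) B);
    \<Gamma> \<setminus> r \<triangleright> TmV (sub1 B0 A) \<triangleright> TmV (wk 1 (sub1 B1 A)) \<triangleright>
      TmV (BridgeT (ren (lft (\<lambda>n. n + 2)) A) (Var 1) (Var 0)) \<turnstile> N \<doteq> N' \<Colon>
      El (BridgeT (subst (BApp (Var 1) (Var 0) ## Var 0 ## (\<lambda>n. Var (n + 4))) B)
        (ren (2 ## (\<lambda>n. n + 3)) N0) (ren (1 ## (\<lambda>n. n + 3)) N1))\<rbrakk> \<Longrightarrow>
    \<Gamma> \<turnstile> Extent r M N0 N1 N \<doteq> Extent r M' N0' N1' N' \<Colon> El (sub2 r M B)"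
| extent0: "\<lbrakk>bdim \<Gamma> r; dimeq \<Gamma> r B0;
    \<Gamma> \<setminus> r \<triangleright> BridgeV \<turnstile> A \<Colon> Ty; \<Gamma> \<setminus> r \<triangleright> BridgeV \<triangleright> TmV A \<turnstile> B \<Colon> Ty;
    \<Gamma> \<turnstile> M \<Colon> El (sub1 r A);
    \<Gamma> \<setminus> r \<triangleright> TmV (sub1 B0 A) \<turnstile> N0 \<Colon> El (subst (up (B0 ## Var)) B);
    \<Gamma> \<setminus> r \<triangleright> TmV (sub1 B1 A) \<turnstile> N1 \<Colon> El (subst (up (B1 ## Var)) B);
    \<Gamma> \<setminus> r \<triangleright> TmV (sub1 B0 A) \<triangleright> TmV (wk 1 (sub1 B1 A)) \<triangleright>
      TmV (BridgeT (ren (lft (\<lambda>n. n + 2)) A) (Var 1) (Var 0)) \<turnstile> N \<Colon>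
      El (BridgeT (subst (BApp (Var 1) (Var 0) ## Var 0 ## (\<lambda>n. Var (n + 4))) B)
        (ren (2 ## (\<lambda>n. n + 3)) N0) (ren (1 ## (\<lambda>n. n + 3)) N1))\<rbrakk> \<Longrightarrow>
    \<Gamma> \<turnstile> Extent r M N0 N1 N \<doteq> sub1 M N0 \<Colon> El (sub2 r M B)"
| extent1: "\<lbrakk>bdim \<Gamma> r; dimeq \<Gamma> r B1;
    \<Gamma> \<setminus> r \<triangleright> BridgeV \<turnstile> A \<Colon> Ty; \<Gamma> \<setminus> r \<triangleright> BridgeV \<triangleright> TmV A \<turnstile> B \<Colon> Ty;
    \<Gamma> \<turnstile> M \<Colon> El (sub1 r A);
    \<Gamma> \<setminus> r \<triangleright> TmV (sub1 B0 A) \<turnstile> N0 \<Colon> El (subst (up (B0 ## Var)) B);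
    \<Gamma> \<setminus> r \<triangleright> TmV (sub1 B1 A) \<turnstile> N1 \<Colon> El (subst (up (B1 ## Var)) B);
    \<Gamma> \<setminus> r \<triangleright> TmV (sub1 B0 A) \<triangleright> TmV (wk 1 (sub1 B1 A)) \<triangleright>
      TmV (BridgeT (ren (lft (\<lambda>n. n + 2)) A) (Var 1) (Var 0)) \<turnstile> N \<Colon>
      El (BridgeT (subst (BApp (Var 1) (Var 0) ## Var 0 ## (\<lambda>n. Var (n + 4))) B)
        (ren (2 ## (\<lambda>n. n + 3)) N0) (ren (1 ## (\<lambda>n. n + 3)) N1))\<rbrakk> \<Longrightarrow>
    \<Gamma> \<turnstile> Extent r M N0 N1 N \<doteq> sub1 M N1 \<Colon> El (sub2 r M B)"
| extent_beta: "\<lbrakk>bdim \<Gamma> r;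
    \<Gamma> \<setminus> r \<triangleright> BridgeV \<turnstile> A \<Colon> Ty; \<Gamma> \<setminus> r \<triangleright> BridgeV \<triangleright> TmV A \<turnstile> B \<Colon> Ty;
    \<Gamma> \<setminus> r \<triangleright> BridgeV \<turnstile> M \<Colon> El A;
    \<Gamma> \<setminus> r \<triangleright> TmV (sub1 B0 A) \<turnstile> N0 \<Colon> El (subst (up (B0 ## Var)) B);
    \<Gamma> \<setminus> r \<triangleright> TmV (sub1 B1 A) \<turnstile> N1 \<Colon> El (subst (up (B1 ## Var)) B);
    \<Gamma> \<setminus> r \<triangleright> TmV (sub1 B0 A) \<triangleright> TmV (wk 1 (sub1 B1 A)) \<triangleright>
      TmV (BridgeT (ren (lft (\<lambda>n. n + 2)) A) (Var 1) (Var 0)) \<turnstile> N \<Colon>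
      El (BridgeT (subst (BApp (Var 1) (Var 0) ## Var 0 ## (\<lambda>n. Var (n + 4))) B)
        (ren (2 ## (\<lambda>n. n + 3)) N0) (ren (1 ## (\<lambda>n. n + 3)) N1))\<rbrakk> \<Longrightarrow>
    \<Gamma> \<turnstile> Extent r (sub1 r M) N0 N1 N \<doteq> BApp (sub3 (sub1 B0 M) (sub1 B1 M) (BLam M) N) r
      \<Colon> El (sub2 r (sub1 r M) B)"

definition inhabited :: "tm \<Rightarrow> bool" where
  "inhabited A \<longleftrightarrow> (\<exists>M. ([], []) \<turnstile> M \<Colon> El A)"

definition is_bridge_discrete :: "tm \<Rightarrow> bool" where
  "is_bridge_discrete A \<longleftrightarrow> inhabited (bridgeDiscrete A)"

end

theory Submission
  imports Defs
begin

text \<open>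
  Bridges between booleans satisfy an induction principle: if \<open>P true true (\<lambda>_. true)\<close> and
  \<open>P false false (\<lambda>_. false)\<close> hold, then \<open>P a b q\<close> holds for every bridge \<open>q\<close> from \<open>a\<close> to \<open>b\<close>.  For
  a fresh bridge dimension \<open>x\<close>, \<open>extent\<close> into the universe defines a family \<open>C\<close> over \<open>m : bool\<close> with
  \<open>C (q@x) = Gel\<^sub>x(bool, bool, _._. P a b q)\<close>, where \<open>bool\<close> only serves as an inhabited type.  The
  premises provide elements of \<open>C true\<close> and \<open>C false\<close>, so \<open>if\<close> yields an element of \<open>C (q@x)\<close>,
  and \<open>ungel\<close> turns it into one of \<open>P a b q\<close>.

  The induction principle gives a map \<open>tighten\<close> from bridges to paths, sending constant bridges to
  constant paths, and a path from \<open>loosen (tighten q)\<close> to \<open>q\<close>.  In the other direction, path induction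
  reduces \<open>tighten (loosen p) = p\<close> to constant \<open>p\<close>, where \<open>if\<close> on the endpoint settles it.

  Weakening is not a rule of the calculus.  Its admissibility is avoided by working with closed terms
  typed in every context, and elsewhere by carrying along all weakenings of a judgment
  (\<open>stable_eq\<close>).  For the same reason the arguments \<open>a, b, q\<close> of the induction are packed into one
  triple: only one \<open>\<beta>\<close>-step is needed, and no typing derivation has to be substituted into.
\<close>


section \<open>Substitution\<close>

lemma lft_simps [simp]: "lft f 0 = 0" "lft f (Suc n) = Suc (f n)"
  by (simp_all add: lft_def)

lemma up_simps [simp]: "up \<sigma> 0 = Var 0" "up \<sigma> (Suc n) = ren Suc (\<sigma> n)"
  by (simp_all add: up_def wk_def)

lemma lft_id: "lft (\<lambda>n. n) = (\<lambda>n. n)"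
proof
  show "lft (\<lambda>n. n) n = n" for n by (cases n) simp_all
qed

lemma up_lft: "(\<lambda>n. up \<sigma> (lft f n)) = up (\<lambda>n. \<sigma> (f n))"
proof
  show "up \<sigma> (lft f n) = up (\<lambda>n. \<sigma> (f n)) n" for n by (cases n) simp_all
qed

lemma up_Var_comp: "up (\<lambda>n. Var (f n)) = (\<lambda>n. Var (lft f n))"
proof
  show "up (\<lambda>n. Var (f n)) n = Var (lft f n)" for n by (cases n) simp_all
qed

lemma lft_comp: "(\<lambda>n. lft f (lft g n)) = lft (\<lambda>n. f (g n))"
proof
  show "lft f (lft g n) = lft (\<lambda>n. f (g n)) n" for n by (cases n) simp_all
qed

lemma subst_ren [simp]: "subst \<sigma> (ren f M) = subst (\<lambda>n. \<sigma> (f n)) M"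
proof (induction f M arbitrary: \<sigma> rule: ren.induct)
  \<comment> \<open>Case 22 is \<open>HCom\<close>: the induction hypotheses are given per tube
    face, so they are first lifted through \<open>map\<close>, with the body of a face below one
    more binder.\<close>
  case (22 f r s A M ts)
  have "map ((\<lambda>(u, v, N). (subst \<sigma> u, subst \<sigma> v, subst (up \<sigma>) N)) \<circ>
      (\<lambda>(u, v, N). (ren f u, ren f v, ren (lft f) N))) ts =
    map (\<lambda>(u, v, N). (subst (\<lambda>n. \<sigma> (f n)) u, subst (\<lambda>n. \<sigma> (f n)) v,
      subst (up (\<lambda>n. \<sigma> (f n))) N)) ts"
    using 22 by (intro map_cong) (auto simp: up_lft)
  with 22 show ?case by simp
qed (simp_all add: up_lft)

lemma ren_ren [simp]: "ren g (ren f M) = ren (\<lambda>n. g (f n)) M"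
proof (induction f M arbitrary: g rule: ren.induct)
  case (22 f r s A M ts)
  have "map ((\<lambda>(u, v, N). (ren g u, ren g v, ren (lft g) N)) \<circ>
      (\<lambda>(u, v, N). (ren f u, ren f v, ren (lft f) N))) ts =
    map (\<lambda>(u, v, N). (ren (\<lambda>n. g (f n)) u, ren (\<lambda>n. g (f n)) v,
      ren (lft (\<lambda>n. g (f n))) N)) ts"
    using 22 by (intro map_cong) (auto simp: lft_comp)
  with 22 show ?case by simp
qed (simp_all add: lft_comp)

lemma subst_Var_comp: "subst (\<lambda>n. Var (f n)) M = ren f M"
proof (induction f M rule: ren.induct)
  case (22 f r s A M ts)
  have "map (\<lambda>(u, v, N). (subst (\<lambda>n. Var (f n)) u, subst (\<lambda>n. Var (f n)) v,
      subst (up (\<lambda>n. Var (f n))) N)) ts =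
    map (\<lambda>(u, v, N). (ren f u, ren f v, ren (lft f) N)) ts"
    using 22 by (intro map_cong) (auto simp: up_Var_comp)
  with 22 show ?case by simp
qed (simp_all add: up_Var_comp)

lemma ren_id: "ren (\<lambda>n. n) M = M"
proof (induction "\<lambda>n::nat. n" M rule: ren.induct)
  case (22 r s A M ts)
  have "map (\<lambda>(u, v, N). (ren (\<lambda>n. n) u, ren (\<lambda>n. n) v, ren (lft (\<lambda>n. n)) N)) ts = ts"
    using 22 by (intro map_idI) (auto simp: lft_id)
  with 22 show ?case by simp
qed (simp_all add: lft_id)

lemma subst_Var [simp]: "subst Var M = M"
  using subst_Var_comp[of "\<lambda>n. n" M] by (simp add: ren_id)

text \<open>Invariance under all renamings and substitutions stands in for the absence of free
  variables, since closed terms are only ever rewritten by these operations.\<close>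

definition closed :: "tm \<Rightarrow> bool" where
  "closed M \<longleftrightarrow> (\<forall>f. ren f M = M) \<and> (\<forall>\<sigma>. subst \<sigma> M = M)"

lemma closedD [simp]: "closed M \<Longrightarrow> ren f M = M" "closed M \<Longrightarrow> subst \<sigma> M = M"
  by (simp_all add: closed_def)

text \<open>Brings weakenings and instantiations into the form \<open>ren\<close> and
  \<open>subst\<close> with successor indices, so that most index bookkeeping becomes
  evaluation.\<close>

lemmas syn = wk_def sub1_def sub2_def sub3_def numeral_eq_Suc subst_Var_comp ren_id


section \<open>Constraint-free contexts\<close>

abbreviation judg0 ("(_ \<tturnstile>/ _ \<doteq>/ _ \<Colon>/ _)" [51, 51, 51, 51] 50) where
  "es \<tturnstile> M \<doteq> N \<Colon> T \<equiv> (es, []) \<turnstile> M \<doteq> N \<Colon> T"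

abbreviation has0 ("(_ \<tturnstile>/ _ \<Colon>/ _)" [51, 51, 51] 50) where
  "es \<tturnstile> M \<Colon> T \<equiv> (es, []) \<turnstile> M \<doteq> M \<Colon> T"

lemma ext_Nil [simp]: "(es, []) \<triangleright> e = (e # es, [])"
  by (simp add: ext_def)

lemma restr_endpoint [simp]: "\<Gamma> \<setminus> B0 = \<Gamma>" "\<Gamma> \<setminus> B1 = \<Gamma>"
  by (simp_all add: restr_def)

lemma restr_0 [simp]: "(e # es, []) \<setminus> Var 0 = (Gone # es, [])"
  by (simp add: restr_def map_upt_Suc map_nth del: upt_Suc)

text \<open>This restriction arises in an \<open>If\<close> motive, where \<open>Var 0\<close> is
  the scrutinee and \<open>Var 1\<close> the bridge dimension; the later term variable disappears
  with the dimension.\<close>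

lemma restr_1 [simp]: "(TmV A # e # es, []) \<setminus> Var (Suc 0) = (Gone # Gone # es, [])"
  by (simp add: restr_def map_upt_Suc map_nth del: upt_Suc)

lemma bdim_simps [simp]: "bdim \<Gamma> B0" "bdim \<Gamma> B1"
    "bdim (BridgeV # es, []) (Var 0)" "bdim (e # BridgeV # es, []) (Var (Suc 0))"
  by (simp_all add: bdim_def entry_is_def)

lemma pdim_simps [simp]: "pdim \<Gamma> I0" "pdim \<Gamma> I1"
    "pdim (PathV # es, cs) (Var 0)" "pdim (e # PathV # es, cs) (Var (Suc 0))"
  by (simp_all add: pdim_def entry_is_def)

lemma univ_simps [simp]: "univ Ty" "univ (El UnivT)"
  by (simp_all add: univ_def)

lemma dimeq_bdim [simp]: "bdim \<Gamma> r \<Longrightarrow> dimeq \<Gamma> r r"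
  by (simp add: dimeq_refl)

lemma dimeq_pdim [simp]: "pdim \<Gamma> r \<Longrightarrow> dimeq \<Gamma> r r"
  by (simp add: dimeq_refl)

section \<open>Derived forms of the typing rules\<close>

lemma eq_left: "\<Gamma> \<turnstile> M \<doteq> N \<Colon> T \<Longrightarrow> \<Gamma> \<turnstile> M \<Colon> T"
  by (rule judg.trans, assumption, rule judg.sym)

lemma eq_right: "\<Gamma> \<turnstile> M \<doteq> N \<Colon> T \<Longrightarrow> \<Gamma> \<turnstile> N \<Colon> T"
  by (rule judg.trans, rule judg.sym)

lemma conv_sym: "\<lbrakk>\<Gamma> \<turnstile> M \<doteq> N \<Colon> El A; \<Gamma> \<turnstile> B \<doteq> A \<Colon> Ty\<rbrakk> \<Longrightarrow> \<Gamma> \<turnstile> M \<doteq> N \<Colon> El B"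
  by (rule judg.conv, assumption, rule judg.sym)

lemma var_el: "\<lbrakk>i < length es; es ! i = TmV A; B = wk (Suc i) A\<rbrakk> \<Longrightarrow> es \<tturnstile> Var i \<Colon> El B"
  using judg.var[of "(es, [])" i A] by (simp add: entry_is_def)

lemma pi_formI: "\<lbrakk>univ S; es \<tturnstile> A \<doteq> A' \<Colon> S; TmV A # es \<tturnstile> B \<doteq> B' \<Colon> S\<rbrakk> \<Longrightarrow>
    es \<tturnstile> PiT A B \<doteq> PiT A' B' \<Colon> S"
  by (rule pi_form) simp_all

lemma lamI: "\<lbrakk>es \<tturnstile> A \<Colon> Ty; TmV A # es \<tturnstile> M \<doteq> M' \<Colon> El B\<rbrakk> \<Longrightarrow>
    es \<tturnstile> Lam M \<doteq> Lam M' \<Colon> El (PiT A B)"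
  by (rule pi_lam) simp_all

lemma appI: "\<lbrakk>es \<tturnstile> M \<doteq> M' \<Colon> El (PiT A B); es \<tturnstile> N \<doteq> N' \<Colon> El A; C = sub1 N B\<rbrakk> \<Longrightarrow>
    es \<tturnstile> App M N \<doteq> App M' N' \<Colon> El C"
  by (auto intro: pi_app)

lemma betaI: "\<lbrakk>es \<tturnstile> A \<Colon> Ty; TmV A # es \<tturnstile> M \<Colon> El B; es \<tturnstile> N \<Colon> El A; M' = sub1 N M; C = sub1 N B\<rbrakk> \<Longrightarrow>
    es \<tturnstile> App (Lam M) N \<doteq> M' \<Colon> El C"
  using pi_beta[of "(es, [])" A M B N] by simp

lemma path_formI: "\<lbrakk>univ S; PathV # es \<tturnstile> A \<doteq> A' \<Colon> S;
    es \<tturnstile> M \<doteq> M' \<Colon> El (sub1 I0 A); es \<tturnstile> N \<doteq> N' \<Colon> El (sub1 I1 A)\<rbrakk> \<Longrightarrow>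
    es \<tturnstile> PathT A M N \<doteq> PathT A' M' N' \<Colon> S"
  by (rule path_form) simp_all

text \<open>\<open>path_lam\<close> yields the ends literally as \<open>sub1 I0 M\<close> and
  \<open>sub1 I1 M\<close>; conversion along an equality of path types replaces them by the wanted
  ends.\<close>

lemma plamI: "\<lbrakk>PathV # es \<tturnstile> A \<Colon> Ty; PathV # es \<tturnstile> M \<doteq> M' \<Colon> El A;
    es \<tturnstile> sub1 I0 M \<doteq> N0 \<Colon> El (sub1 I0 A); es \<tturnstile> sub1 I1 M \<doteq> N1 \<Colon> El (sub1 I1 A)\<rbrakk> \<Longrightarrow>
    es \<tturnstile> PLam M \<doteq> PLam M' \<Colon> El (PathT A N0 N1)"
  using path_lam[of "(es, [])" M M' A] path_formI[of Ty es A A "sub1 I0 M" N0 "sub1 I1 M" N1]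
  by (simp add: judg.conv)

lemma pappI: "\<lbrakk>es \<tturnstile> M \<doteq> M' \<Colon> El (PathT A N0 N1); pdim (es, []) r; B = sub1 r A\<rbrakk> \<Longrightarrow>
    es \<tturnstile> PApp M r \<doteq> PApp M' r \<Colon> El B"
  by (auto intro: path_app)

lemma pbetaI: "\<lbrakk>PathV # es \<tturnstile> M \<Colon> El A; pdim (es, []) r; M' = sub1 r M; B = sub1 r A\<rbrakk> \<Longrightarrow>
    es \<tturnstile> PApp (PLam M) r \<doteq> M' \<Colon> El B"
  using path_beta[of "(es, [])" M A r] by simp

lemma coeI: "\<lbrakk>PathV # es \<tturnstile> A \<doteq> A' \<Colon> Ty; es \<tturnstile> M \<doteq> M' \<Colon> El (sub1 r A);
    pdim (es, []) r; pdim (es, []) s; B = sub1 s A\<rbrakk> \<Longrightarrow>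
    es \<tturnstile> Coe A r s M \<doteq> Coe A' r s M' \<Colon> El B"
  by (auto intro: coe)

lemma coe_idI: "\<lbrakk>PathV # es \<tturnstile> A \<Colon> Ty; es \<tturnstile> M \<Colon> El (sub1 r A); pdim (es, []) r; B = sub1 r A\<rbrakk> \<Longrightarrow>
    es \<tturnstile> Coe A r r M \<doteq> M \<Colon> El B"
  using coe_id[of "(es, [])" A M r] by simp

lemma bridge_formI: "\<lbrakk>univ S; BridgeV # es \<tturnstile> A \<doteq> A' \<Colon> S;
    es \<tturnstile> M \<doteq> M' \<Colon> El (sub1 B0 A); es \<tturnstile> N \<doteq> N' \<Colon> El (sub1 B1 A)\<rbrakk> \<Longrightarrow>
    es \<tturnstile> BridgeT A M N \<doteq> BridgeT A' M' N' \<Colon> S"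
  by (rule bridge_form) simp_all

lemma blamI: "\<lbrakk>BridgeV # es \<tturnstile> A \<Colon> Ty; BridgeV # es \<tturnstile> M \<doteq> M' \<Colon> El A;
    es \<tturnstile> sub1 B0 M \<doteq> N0 \<Colon> El (sub1 B0 A); es \<tturnstile> sub1 B1 M \<doteq> N1 \<Colon> El (sub1 B1 A)\<rbrakk> \<Longrightarrow>
    es \<tturnstile> BLam M \<doteq> BLam M' \<Colon> El (BridgeT A N0 N1)"
  using bridge_lam[of "(es, [])" M M' A] bridge_formI[of Ty es A A "sub1 B0 M" N0 "sub1 B1 M" N1]
  by (simp add: judg.conv)

lemma bappI: "\<lbrakk>bdim (es, []) r; (es, []) \<setminus> r = (es', []); es' \<tturnstile> M \<doteq> M' \<Colon> El (BridgeT A N0 N1);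
    B = sub1 r A\<rbrakk> \<Longrightarrow> es \<tturnstile> BApp M r \<doteq> BApp M' r \<Colon> El B"
  by (auto intro: bridge_app)

lemma bapp_endpoint:
  assumes "es \<tturnstile> M \<Colon> El (BridgeT A N0 N1)"
  shows "es \<tturnstile> BApp M B0 \<doteq> N0 \<Colon> El (sub1 B0 A)" "es \<tturnstile> BApp M B1 \<doteq> N1 \<Colon> El (sub1 B1 A)"
  using assms by (auto intro: bridge_app0 bridge_app1)

lemma bbetaI: "\<lbrakk>bdim (es, []) r; (es, []) \<setminus> r = (es', []); BridgeV # es' \<tturnstile> M \<Colon> El A;
    M' = sub1 r M; B = sub1 r A\<rbrakk> \<Longrightarrow> es \<tturnstile> BApp (BLam M) r \<doteq> M' \<Colon> El B"
  using bridge_beta[of "(es, [])" r M A] by simp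

lemma bool_typing [simp]: "\<Gamma> \<turnstile> BoolT \<Colon> Ty" "\<Gamma> \<turnstile> BoolT \<Colon> El UnivT" "\<Gamma> \<turnstile> UnivT \<Colon> Ty"
    "\<Gamma> \<turnstile> TT \<Colon> El BoolT" "\<Gamma> \<turnstile> FF \<Colon> El BoolT"
  by (simp_all add: bool_form bool_true bool_false univ_form)


section \<open>The type of bridges between booleans\<close>

definition BoolBridge :: tm where
  "BoolBridge = SigT BoolT (SigT BoolT (BridgeT BoolT (Var 1) (Var 0)))"

definition trip :: "tm \<Rightarrow> tm \<Rightarrow> tm \<Rightarrow> tm" where
  "trip a b q = Pr a (Pr b q)"

text \<open>The body of \<open>BLam\<close> is \<open>b\<close> without weakening, so this is the
  constant bridge for closed \<open>b\<close>; it is applied to \<open>TT\<close> and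
  \<open>FF\<close>.\<close>

definition cbr :: "tm \<Rightarrow> tm" where
  "cbr b = trip b b (BLam b)"

lemma BoolBridge_subst [simp]: "ren f BoolBridge = BoolBridge" "subst \<sigma> BoolBridge = BoolBridge"
  by (simp_all add: BoolBridge_def)

lemma trip_subst [simp]: "ren f (trip a b q) = trip (ren f a) (ren f b) (ren f q)"
    "subst \<sigma> (trip a b q) = trip (subst \<sigma> a) (subst \<sigma> b) (subst \<sigma> q)"
  by (simp_all add: trip_def)

lemma bridge_bool: "\<lbrakk>univ S; es \<tturnstile> a \<doteq> a' \<Colon> El BoolT; es \<tturnstile> b \<doteq> b' \<Colon> El BoolT\<rbrakk> \<Longrightarrow>
    es \<tturnstile> BridgeT BoolT a b \<doteq> BridgeT BoolT a' b' \<Colon> S"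
  by (rule bridge_formI) (auto simp: syn bool_form)

lemma path_bool: "\<lbrakk>univ S; es \<tturnstile> a \<doteq> a' \<Colon> El BoolT; es \<tturnstile> b \<doteq> b' \<Colon> El BoolT\<rbrakk> \<Longrightarrow>
    es \<tturnstile> PathT BoolT a b \<doteq> PathT BoolT a' b' \<Colon> S"
  by (rule path_formI) (auto simp: syn bool_form)

lemma BoolBridge_type: "univ S \<Longrightarrow> es \<tturnstile> BoolBridge \<Colon> S"
  unfolding BoolBridge_def
  by (intro sig_form) (auto intro!: bridge_bool var_el bool_form simp: syn)

text \<open>Assumption \<open>w\<close> supplies the one weakening required: the type of the second
  component mentions \<open>a\<close> below the binder of the second endpoint.\<close>

lemma trip_eq:
  assumes a: "es \<tturnstile> a \<doteq> a' \<Colon> El BoolT" and b: "es \<tturnstile> b \<doteq> b' \<Colon> El BoolT"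
    and q: "es \<tturnstile> q \<doteq> q' \<Colon> El (BridgeT BoolT a b)"
    and w: "TmV BoolT # es \<tturnstile> ren Suc a \<Colon> El BoolT"
  shows "es \<tturnstile> trip a b q \<doteq> trip a' b' q' \<Colon> El BoolBridge"
proof -
  have 1: "es \<tturnstile> Pr b q \<doteq> Pr b' q' \<Colon> El (SigT BoolT (BridgeT BoolT (ren Suc a) (Var 0)))"
    by (rule sig_pair[OF b]) (use q w in \<open>auto intro!: bridge_bool var_el simp: syn\<close>)
  show ?thesis unfolding trip_def BoolBridge_def
    by (rule sig_pair[OF a])
      (use 1 in \<open>auto intro!: sig_form bridge_bool var_el bool_form simp: syn\<close>)
qed

lemma proj_eq:
  assumes "es \<tturnstile> s \<doteq> s' \<Colon> El BoolBridge"
  shows "es \<tturnstile> Fst s \<doteq> Fst s' \<Colon> El BoolT"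
    and "es \<tturnstile> Snd s \<doteq> Snd s' \<Colon> El (SigT BoolT (BridgeT BoolT (ren Suc (Fst s)) (Var 0)))"
    and "es \<tturnstile> Fst (Snd s) \<doteq> Fst (Snd s') \<Colon> El BoolT"
    and "es \<tturnstile> Snd (Snd s) \<doteq> Snd (Snd s') \<Colon> El (BridgeT BoolT (Fst s) (Fst (Snd s)))"
proof -
  show "es \<tturnstile> Fst s \<doteq> Fst s' \<Colon> El BoolT"
    using assms unfolding BoolBridge_def by (rule sig_fst)
  show 2: "es \<tturnstile> Snd s \<doteq> Snd s' \<Colon> El (SigT BoolT (BridgeT BoolT (ren Suc (Fst s)) (Var 0)))"
    using sig_snd[OF assms[unfolded BoolBridge_def]] by (simp add: syn)
  show "es \<tturnstile> Fst (Snd s) \<doteq> Fst (Snd s') \<Colon> El BoolT"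
    using 2 by (rule sig_fst)
  show "es \<tturnstile> Snd (Snd s) \<doteq> Snd (Snd s') \<Colon> El (BridgeT BoolT (Fst s) (Fst (Snd s)))"
    using sig_snd[OF 2] by (simp add: syn)
qed

lemma proj_trip:
  assumes a: "es \<tturnstile> a \<Colon> El BoolT" and b: "es \<tturnstile> b \<Colon> El BoolT"
    and q: "es \<tturnstile> q \<Colon> El (BridgeT BoolT a b)"
    and w: "TmV BoolT # es \<tturnstile> ren Suc a \<Colon> El BoolT"
  shows "es \<tturnstile> Fst (trip a b q) \<doteq> a \<Colon> El BoolT"
    and "es \<tturnstile> Fst (Snd (trip a b q)) \<doteq> b \<Colon> El BoolT"
    and "es \<tturnstile> Snd (Snd (trip a b q)) \<doteq> q \<Colon> El (BridgeT BoolT a b)"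
proof -
  let ?B = "SigT BoolT (BridgeT BoolT (ren Suc a) (Var 0))"
  have B: "(es, []) \<triangleright> TmV BoolT \<turnstile> SigT BoolT (BridgeT BoolT (Var 1) (Var 0)) \<Colon> Ty"
    by (auto intro!: sig_form bridge_bool var_el bool_form simp: syn)
  have B': "(es, []) \<triangleright> TmV BoolT \<turnstile> BridgeT BoolT (ren Suc a) (Var 0) \<Colon> Ty"
    using w by (auto intro!: bridge_bool var_el simp: syn)
  have q': "es \<tturnstile> q \<Colon> El (sub1 b (BridgeT BoolT (ren Suc a) (Var 0)))"
    using q by (simp add: syn)
  have 1: "es \<tturnstile> Pr b q \<Colon> El (sub1 a (SigT BoolT (BridgeT BoolT (Var 1) (Var 0))))"
    using sig_pair[OF b B' q'] by (simp add: syn)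
  show "es \<tturnstile> Fst (trip a b q) \<doteq> a \<Colon> El BoolT"
    unfolding trip_def by (rule sig_beta1[OF a B 1])
  have 2: "es \<tturnstile> Snd (trip a b q) \<doteq> Pr b q \<Colon> El ?B"
    using sig_beta2[OF a B 1] unfolding trip_def by (simp add: syn)
  show "es \<tturnstile> Fst (Snd (trip a b q)) \<doteq> b \<Colon> El BoolT"
    by (rule judg.trans[OF sig_fst[OF 2] sig_beta1[OF b B' q']])
  have eq: "es \<tturnstile> Fst (Pr b q) \<doteq> b \<Colon> El BoolT"
    by (rule sig_beta1[OF b B' q'])
  \<comment> \<open>The right end of the bridge type first appears as
    \<open>Fst (Snd (trip a b q))\<close> and has to be converted to \<open>b\<close> before the
    last projection is computed.\<close>
  have "es \<tturnstile> Snd (Snd (trip a b q)) \<doteq> Snd (Pr b q) \<Colon> El (BridgeT BoolT a (Fst (Snd (trip a b q))))"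
    using sig_snd[OF 2] by (simp add: syn)
  then have "es \<tturnstile> Snd (Snd (trip a b q)) \<doteq> Snd (Pr b q) \<Colon> El (BridgeT BoolT a b)"
    by (rule conv) (auto intro: bridge_bool a judg.trans[OF sig_fst[OF 2] eq])
  moreover have "es \<tturnstile> Snd (Pr b q) \<doteq> q \<Colon> El (BridgeT BoolT a b)"
    using sig_beta2[OF b B' q'] by (simp add: syn)
  ultimately show "es \<tturnstile> Snd (Snd (trip a b q)) \<doteq> q \<Colon> El (BridgeT BoolT a b)"
    by (rule judg.trans)
qed

text \<open>Eta for pairs, first for the inner pair and then for the outer one.\<close>

lemma trip_proj:
  assumes s: "es \<tturnstile> s \<Colon> El BoolBridge"
    and w: "TmV BoolT # es \<tturnstile> ren Suc s \<Colon> El BoolBridge"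
  shows "es \<tturnstile> trip (Fst s) (Fst (Snd s)) (Snd (Snd s)) \<doteq> s \<Colon> El BoolBridge"
proof -
  have "es \<tturnstile> Pr (Fst (Snd s)) (Snd (Snd s)) \<doteq> Snd s \<Colon> El (SigT BoolT (BridgeT BoolT (ren Suc (Fst s)) (Var 0)))"
    by (rule judg.sym[OF sig_eta[OF proj_eq(2)[OF s]]])
  then have "es \<tturnstile> Pr (Fst s) (Pr (Fst (Snd s)) (Snd (Snd s))) \<doteq> Pr (Fst s) (Snd s) \<Colon> El BoolBridge"
    unfolding BoolBridge_def
    by (intro sig_pair[OF proj_eq(1)[OF s]])
      (auto intro!: sig_form bridge_bool var_el bool_form simp: syn)
  moreover have "es \<tturnstile> Pr (Fst s) (Snd s) \<doteq> s \<Colon> El BoolBridge"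
    using judg.sym[OF sig_eta[OF s[unfolded BoolBridge_def]]] by (simp add: BoolBridge_def)
  ultimately show ?thesis unfolding trip_def by (rule judg.trans)
qed

lemma cbr_typing [simp]:
  assumes "b \<in> {TT, FF}"
  shows "es \<tturnstile> cbr b \<Colon> El BoolBridge" "es \<tturnstile> BLam b \<Colon> El (BridgeT BoolT b b)" "ren f (cbr b) = cbr b"
    "subst \<sigma> (cbr b) = cbr b"
  using assms unfolding cbr_def by (auto intro!: trip_eq blamI simp: syn)


section \<open>Induction on bridges between booleans\<close>

text \<open>The indices 5, 4, 3 are the variables \<open>a0, a1, c\<close> of the bridge branch of
  \<open>Extent\<close>, moved past the dimension of \<open>BLam\<close> and the two variables of
  the Gel relation. The relation is constant in the latter two.\<close>

definition gel_fam :: "tm \<Rightarrow> tm" where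
  "gel_fam P = BLam (GelT (Var 0) BoolT BoolT (App P (trip (Var 5) (Var 4) (Var 3))))"

text \<open>Both end branches are the constant type \<open>BoolT\<close>, matching the two ends of
  the Gel-type in the bridge branch.\<close>

definition code :: "tm \<Rightarrow> tm \<Rightarrow> tm \<Rightarrow> tm" where
  "code P r m = Extent r m BoolT BoolT (gel_fam P)"

text \<open>In the motive of \<open>If\<close>, \<open>Var 0\<close> is the boolean bound there and
  \<open>Var 1\<close> the dimension bound by \<open>Ungel\<close>. The two occurrences of
  \<open>TT\<close> in each \<open>Gel\<close> are arbitrary elements of the end types.\<close>

definition ind_body :: "tm \<Rightarrow> tm \<Rightarrow> tm \<Rightarrow> tm \<Rightarrow> tm" where
  "ind_body P t f s = Ungel (If (code P (Var 1) (Var 0)) (BApp (Snd (Snd (ren Suc s))) (Var 0))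
     (Gel (Var 0) TT TT t) (Gel (Var 0) TT TT f))"

definition bridge_ind :: "tm \<Rightarrow> tm \<Rightarrow> tm \<Rightarrow> tm" where
  "bridge_ind P t f = Lam (ind_body P t f (Var 0))"

text \<open>\<open>extent_beta\<close> produces a triple by abstracting an applied bridge again and
  reading off its ends. By the endpoint rules and eta for bridges this is the triple of the
  projections of \<open>s\<close>, hence \<open>s\<close>.\<close>

lemma bridge_eta_trip:
  assumes s: "es \<tturnstile> s \<Colon> El BoolBridge" and w: "TmV BoolT # es \<tturnstile> ren Suc s \<Colon> El BoolBridge"
  shows "es \<tturnstile> trip (BApp (Snd (Snd s)) B0) (BApp (Snd (Snd s)) B1)
    (BLam (BApp (Snd (Snd (ren Suc s))) (Var 0))) \<doteq> s \<Colon> El BoolBridge"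
proof -
  let ?q = "Snd (Snd s)"
  note q = proj_eq(4)[OF s]
  have e: "es \<tturnstile> BApp ?q B0 \<doteq> Fst s \<Colon> El BoolT" "es \<tturnstile> BApp ?q B1 \<doteq> Fst (Snd s) \<Colon> El BoolT"
    using bapp_endpoint[OF q] by (simp_all add: syn)
  have w': "TmV BoolT # es \<tturnstile> ren Suc (BApp ?q B0) \<Colon> El BoolT"
    using eq_left[OF bapp_endpoint(1)[OF proj_eq(4)[OF w]]] by (simp add: syn)
  have "es \<tturnstile> BLam (BApp (Snd (Snd (ren Suc s))) (Var 0)) \<doteq> ?q \<Colon> El (BridgeT BoolT (Fst s) (Fst (Snd s)))"
    using judg.sym[OF bridge_eta[OF q]] by (simp add: syn)
  then have "es \<tturnstile> BLam (BApp (Snd (Snd (ren Suc s))) (Var 0)) \<doteq> ?q \<Colon>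
      El (BridgeT BoolT (BApp ?q B0) (BApp ?q B1))"
    by (rule conv_sym) (intro bridge_bool e univ_simps)
  then have "es \<tturnstile> trip (BApp ?q B0) (BApp ?q B1) (BLam (BApp (Snd (Snd (ren Suc s))) (Var 0))) \<doteq>
      trip (Fst s) (Fst (Snd s)) ?q \<Colon> El BoolBridge"
    by (intro trip_eq e w')
  then show ?thesis
    by (rule judg.trans) (rule trip_proj[OF s w])
qed

text \<open>The motive and the two base cases are closed and typed in every context, so they can be
  used below any binder without weakening a derivation.\<close>

locale bool_bridge_motive =
  fixes P t f :: tm
  assumes cl [simp]: "closed P" "closed t" "closed f"
    and P: "\<And>es. es \<tturnstile> P \<Colon> El (PiT BoolBridge UnivT)"
    and t: "\<And>es. es \<tturnstile> t \<Colon> El (App P (cbr TT))"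
    and f: "\<And>es. es \<tturnstile> f \<Colon> El (App P (cbr FF))"
begin

lemma App_P:
  assumes "univ S" "es \<tturnstile> s \<doteq> s' \<Colon> El BoolBridge"
  shows "es \<tturnstile> App P s \<doteq> App P s' \<Colon> S"
  using assms appI[OF P assms(2), of UnivT] by (auto simp: univ_def syn intro: univ_el)

lemma closed_fam [simp]: "ren (lft (lft (lft g))) (gel_fam P) = gel_fam P"
    "subst (up (up (up \<sigma>))) (gel_fam P) = gel_fam P"
  by (simp_all add: gel_fam_def syn)

lemma code_subst [simp]: "ren g (code P r m) = code P (ren g r) (ren g m)"
    "subst \<sigma> (code P r m) = code P (subst \<sigma> r) (subst \<sigma> m)"
  by (simp_all add: code_def)

lemma gel_typeI:
  assumes "univ S" "bdim (es, []) r" "(es, []) \<setminus> r = (es', [])"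
    and "TmV BoolT # TmV BoolT # es' \<tturnstile> s \<doteq> s' \<Colon> El BoolBridge"
  shows "es \<tturnstile> GelT r BoolT BoolT (App P s) \<doteq> GelT r BoolT BoolT (App P s') \<Colon> S"
  using assms by (intro gel_form) (auto simp: syn bool_form App_P)

lemma gel_fam_type:
  "TmV (BridgeT BoolT (Var 1) (Var 0)) # TmV BoolT # TmV BoolT # es \<tturnstile> gel_fam P \<Colon>
    El (BridgeT UnivT BoolT BoolT)" (is "?D \<tturnstile> _ \<Colon> _")
proof -
  \<comment> \<open>\<open>Gone\<close> is the dimension of the Gel-type: removed by the
    restriction, but still occupying an index.\<close>
  have 1: "TmV BoolT # TmV BoolT # Gone # ?D \<tturnstile> trip (Var 5) (Var 4) (Var 3) \<Colon> El BoolBridge"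
    by (intro trip_eq) (auto intro!: var_el simp: syn)
  \<comment> \<open>At an endpoint the bound dimension has been substituted away, so the indices
    drop by one.\<close>
  have 2: "TmV BoolT # TmV BoolT # ?D \<tturnstile> App P (trip (Var 4) (Var 3) (Var 2)) \<Colon> El UnivT"
    by (intro App_P trip_eq) (auto intro!: var_el simp: syn)
  show ?thesis unfolding gel_fam_def
  proof (rule blamI)
    show "BridgeV # ?D \<tturnstile> GelT (Var 0) BoolT BoolT (App P (trip (Var 5) (Var 4) (Var 3))) \<Colon> El UnivT"
      using 1 by (intro gel_typeI) simp_all
    show "?D \<tturnstile> sub1 B0 (GelT (Var 0) BoolT BoolT (App P (trip (Var 5) (Var 4) (Var 3)))) \<doteq> BoolT \<Colon>
        El (sub1 B0 UnivT)"
      using 2 gel_form0[of "El UnivT" "(?D, [])" B0 BoolT BoolT "App P (trip (Var 4) (Var 3) (Var 2))"]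
      by (simp add: syn)
    show "?D \<tturnstile> sub1 B1 (GelT (Var 0) BoolT BoolT (App P (trip (Var 5) (Var 4) (Var 3)))) \<doteq> BoolT \<Colon>
        El (sub1 B1 UnivT)"
      using 2 gel_form1[of "El UnivT" "(?D, [])" B1 BoolT BoolT "App P (trip (Var 4) (Var 3) (Var 2))"]
      by (simp add: syn)
  qed simp
qed

text \<open>\<open>extent\<close> restricts the context of its branches but not that of its
  scrutinee. Hence \<open>code\<close> is a family even over a boolean variable declared after the
  dimension.\<close>

lemma code_eq:
  assumes "univ S" "bdim (es, []) r" "(es, []) \<setminus> r = (es', [])" "es \<tturnstile> m \<doteq> m' \<Colon> El BoolT"
  shows "es \<tturnstile> code P r m \<doteq> code P r m' \<Colon> S"
proof -
  have "es \<tturnstile> code P r m \<doteq> code P r m' \<Colon> El (sub2 r m UnivT)"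
    unfolding code_def
    by (rule extent[where A = BoolT]) (use assms gel_fam_type[of es'] in \<open>simp_all add: syn\<close>)
  then show ?thesis
    using assms(1) by (auto simp: univ_def syn intro: univ_el)
qed

text \<open>For a scrutinee given as an instance of a line \<open>M\<close>,
  \<open>extent_beta\<close> feeds the bridge branch with the ends of \<open>M\<close> and with
  \<open>BLam M\<close>. Assumption \<open>s\<close> simplifies this triple in all weakenings
  because it occurs below the binders of the Gel relation.\<close>

lemma code_beta:
  assumes M: "BridgeV # Gone # ds \<tturnstile> M \<Colon> El BoolT"
    and s: "\<And>pre. pre @ Gone # ds \<tturnstile> wk (length pre) (trip (sub1 B0 M) (sub1 B1 M) (BLam M)) \<doteq>
      wk (length pre) s \<Colon> El BoolBridge"
    and S: "univ S"
  shows "BridgeV # ds \<tturnstile> code P (Var 0) (sub1 (Var 0) M) \<doteq> GelT (Var 0) BoolT BoolT (App P (wk 2 s)) \<Colon> S"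
proof -
  let ?T = "trip (sub1 B0 M) (sub1 B1 M) (BLam M)"
  let ?G = "\<lambda>k. GelT (Var 0) BoolT BoolT (App P (wk k ?T))"
  have "BridgeV # ds \<tturnstile> code P (Var 0) (sub1 (Var 0) M) \<doteq>
      BApp (sub3 (sub1 B0 M) (sub1 B1 M) (BLam M) (gel_fam P)) (Var 0) \<Colon> El (sub2 (Var 0) (sub1 (Var 0) M) UnivT)"
    unfolding code_def
    by (rule extent_beta[where A = BoolT]) (use M gel_fam_type[of "Gone # ds"] in \<open>simp_all add: syn\<close>)
  \<comment> \<open>Three weakenings account for the dimension bound by \<open>BLam\<close> and the
    two relation variables; the beta step below removes the first.\<close>
  moreover have "sub3 (sub1 B0 M) (sub1 B1 M) (BLam M) (gel_fam P) = BLam (?G 3)"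
    by (simp add: gel_fam_def syn lft_comp)
  ultimately have 1: "BridgeV # ds \<tturnstile> code P (Var 0) (sub1 (Var 0) M) \<doteq> BApp (BLam (?G 3)) (Var 0) \<Colon> El UnivT"
    by (simp add: syn)
  have "BridgeV # Gone # ds \<tturnstile> ?G 3 \<Colon> El UnivT"
    using eq_left[OF s[of "[TmV BoolT, TmV BoolT, Gone]"]] by (intro gel_typeI) (simp_all add: numeral_eq_Suc)
  then have 2: "BridgeV # ds \<tturnstile> BApp (BLam (?G 3)) (Var 0) \<doteq> ?G 2 \<Colon> El UnivT"
    by (rule bbetaI[rotated 2]) (simp_all add: syn up_lft up_Var_comp lft_comp)
  have 3: "BridgeV # ds \<tturnstile> ?G 2 \<doteq> GelT (Var 0) BoolT BoolT (App P (wk 2 s)) \<Colon> El UnivT"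
    using s[of "[TmV BoolT, TmV BoolT]"] by (intro gel_typeI) (simp_all add: numeral_eq_Suc)
  show ?thesis
    using judg.trans[OF judg.trans[OF 1 2] 3] S by (auto simp: univ_def intro: univ_el)
qed

lemma code_cbr:
  assumes "b \<in> {TT, FF}" "univ S"
  shows "BridgeV # ds \<tturnstile> code P (Var 0) b \<doteq> GelT (Var 0) BoolT BoolT (App P (cbr b)) \<Colon> S"
  using code_beta[of ds b "cbr b" S] assms cbr_typing[OF assms(1)] by (auto simp: syn cbr_def)

lemma branch_typing:
  assumes b: "b \<in> {TT, FF}" and v: "closed v" "\<And>es. es \<tturnstile> v \<Colon> El (App P (cbr b))"
  shows "BridgeV # ds \<tturnstile> Gel (Var 0) TT TT v \<Colon> El (code P (Var 0) b)"
proof (rule conv_sym[OF _ code_cbr[OF b]])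
  show "BridgeV # ds \<tturnstile> Gel (Var 0) TT TT v \<Colon> El (GelT (Var 0) BoolT BoolT (App P (cbr b)))"
    using assms by (intro gel_intro) (auto intro!: App_P simp: syn)
qed simp

lemma if_eq:
  assumes "BridgeV # ds \<tturnstile> m \<doteq> m' \<Colon> El BoolT"
  shows "BridgeV # ds \<tturnstile> If (code P (Var 1) (Var 0)) m (Gel (Var 0) TT TT t) (Gel (Var 0) TT TT f) \<doteq>
     If (code P (Var 1) (Var 0)) m' (Gel (Var 0) TT TT t) (Gel (Var 0) TT TT f) \<Colon> El (code P (Var 0) m)"
proof -
  have "(BridgeV # ds, []) \<triangleright> TmV BoolT \<turnstile> code P (Var 1) (Var 0) \<Colon> Ty"
    by (simp, rule code_eq) (auto intro!: var_el simp: syn)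
  from bool_if[OF this assms, of "Gel (Var 0) TT TT t" "Gel (Var 0) TT TT t" "Gel (Var 0) TT TT f" "Gel (Var 0) TT TT f"]
  show ?thesis
    using branch_typing[of TT t ds] branch_typing[of FF f ds] t f by (simp add: syn)
qed

text \<open>The relation is constant in its two variables, so \<open>Ungel Q\<close> has type
  \<open>App P s\<close> whatever the ends of \<open>Q\<close> are.\<close>

lemma ungel_typing:
  assumes "\<And>pre. pre @ ds \<tturnstile> wk (length pre) s \<Colon> El BoolBridge"
    and Q: "BridgeV # ds \<tturnstile> Q \<doteq> Q' \<Colon> El (GelT (Var 0) BoolT BoolT (App P (wk 3 s)))"
  shows "ds \<tturnstile> Ungel Q \<doteq> Ungel Q' \<Colon> El (App P s)"
  using gel_elim[of "(ds, [])" BoolT BoolT "App P (wk 2 s)" Q Q'] Q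
    assms(1)[of "[TmV BoolT, TmV BoolT]"]
  by (simp add: syn App_P)

text \<open>Write \<open>q\<close> for the bridge in \<open>s\<close>. \<open>code_beta\<close> for
  the line \<open>q@x\<close>, combined with \<open>bridge_eta_trip\<close>, turns the code of
  \<open>q@x\<close> into the Gel-type over \<open>App P s\<close>. Assumption \<open>s'\<close>
  gives \<open>s\<close> in restricted contexts, where \<open>Gone\<close> takes the place of
  \<open>x\<close>.\<close>

lemma ind_body_typing:
  assumes s: "\<And>pre. pre @ ds \<tturnstile> wk (length pre) s \<Colon> El BoolBridge"
    and s': "\<And>pre. pre @ Gone # ds \<tturnstile> wk (Suc (length pre)) s \<Colon> El BoolBridge"
  shows "ds \<tturnstile> ind_body P t f s \<Colon> El (App P s)"
proof -
  let ?M = "BApp (Snd (Snd (wk 2 s))) (Var 0)"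
  have M: "BridgeV # Gone # ds \<tturnstile> ?M \<Colon> El BoolT"
    using s'[of "[Gone]"] by (intro bappI) (auto intro: proj_eq simp: syn)
  \<comment> \<open>The same application at the actual dimension, whereas \<open>?M\<close> has a
    fresh dimension on top of the restricted context, as \<open>extent_beta\<close>
    requires.\<close>
  have m: "BridgeV # ds \<tturnstile> BApp (Snd (Snd (ren Suc s))) (Var 0) \<Colon> El BoolT"
    using s'[of "[]"] by (intro bappI) (auto intro: proj_eq simp: syn)
  have "BridgeV # ds \<tturnstile> code P (Var 0) (sub1 (Var 0) ?M) \<doteq> GelT (Var 0) BoolT BoolT (App P (wk 2 (wk 1 s))) \<Colon> Ty"
  proof (rule code_beta[OF M])
    fix pre
    show "pre @ Gone # ds \<tturnstile> wk (length pre) (trip (sub1 B0 ?M) (sub1 B1 ?M) (BLam ?M)) \<doteq>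
      wk (length pre) (wk 1 s) \<Colon> El BoolBridge"
      using bridge_eta_trip[of "pre @ Gone # ds" "wk (Suc (length pre)) s"] s'[of pre] s'[of "TmV BoolT # pre"]
      by (simp add: syn)
  qed simp
  then have c: "BridgeV # ds \<tturnstile> code P (Var 0) (BApp (Snd (Snd (ren Suc s))) (Var 0)) \<doteq>
      GelT (Var 0) BoolT BoolT (App P (wk 3 s)) \<Colon> Ty"
    by (simp add: syn)
  show ?thesis unfolding ind_body_def
    by (rule ungel_typing[OF s]) (rule conv[OF if_eq[OF m] c])
qed

text \<open>The computation rule holds exactly: the applied constant bridge reduces to
  \<open>b\<close>, \<open>If\<close> selects a branch, and \<open>gel_beta\<close> undoes the
  \<open>Gel\<close>.\<close>

lemma ind_body_cbr:
  assumes b: "(b, v) \<in> {(TT, t), (FF, f)}"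
  shows "ds \<tturnstile> ind_body P t f (cbr b) \<doteq> v \<Colon> El (App P (cbr b))"
proof -
  have b': "b \<in> {TT, FF}" and v: "closed v" "\<And>es. es \<tturnstile> v \<Colon> El (App P (cbr b))"
    using b t f by auto
  have "Gone # ds \<tturnstile> Snd (Snd (cbr b)) \<doteq> BLam b \<Colon> El (BridgeT BoolT b b)"
    using b' unfolding cbr_def by (intro proj_trip) auto
  then have "BridgeV # ds \<tturnstile> BApp (Snd (Snd (cbr b))) (Var 0) \<doteq> BApp (BLam b) (Var 0) \<Colon> El BoolT"
    by (intro bappI) (auto simp: syn)
  moreover have "BridgeV # ds \<tturnstile> BApp (BLam b) (Var 0) \<doteq> b \<Colon> El BoolT"
    using b' by (intro bbetaI[where A = BoolT]) (auto simp: syn)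
  ultimately have m: "BridgeV # ds \<tturnstile> b \<doteq> BApp (Snd (Snd (cbr b))) (Var 0) \<Colon> El BoolT"
    by (metis judg.sym judg.trans)
  let ?If = "\<lambda>m. If (code P (Var 1) (Var 0)) m (Gel (Var 0) TT TT t) (Gel (Var 0) TT TT f)"
  have C: "(BridgeV # ds, []) \<triangleright> TmV BoolT \<turnstile> code P (Var 1) (Var 0) \<Colon> Ty"
    by (simp, rule code_eq) (auto intro!: var_el simp: syn)
  have "BridgeV # ds \<tturnstile> ?If b \<doteq> Gel (Var 0) TT TT v \<Colon> El (code P (Var 0) b)"
    using bool_beta_true[OF C, of "Gel (Var 0) TT TT t" "Gel (Var 0) TT TT f"]
      bool_beta_false[OF C, of "Gel (Var 0) TT TT t" "Gel (Var 0) TT TT f"]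
      branch_typing[of TT t ds] branch_typing[of FF f ds] t f b by (auto simp: syn)
  then have "BridgeV # ds \<tturnstile> ?If (BApp (Snd (Snd (cbr b))) (Var 0)) \<doteq> Gel (Var 0) TT TT v \<Colon> El (code P (Var 0) b)"
    using judg.sym[OF if_eq[OF m]] by (rule judg.trans[rotated])
  then have "BridgeV # ds \<tturnstile> ?If (BApp (Snd (Snd (cbr b))) (Var 0)) \<doteq> Gel (Var 0) TT TT v \<Colon>
      El (GelT (Var 0) BoolT BoolT (App P (wk 3 (cbr b))))"
    by (rule conv) (use code_cbr[OF b', of Ty] b' in \<open>simp add: syn\<close>)
  then have "ds \<tturnstile> ind_body P t f (cbr b) \<doteq> Ungel (Gel (Var 0) TT TT v) \<Colon> El (App P (cbr b))"
    using ungel_typing[of ds "cbr b"] b' by (simp add: ind_body_def syn)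
  moreover have "ds \<tturnstile> Ungel (Gel (Var 0) TT TT v) \<doteq> v \<Colon> El (App P (cbr b))"
    using gel_beta[of "(ds, [])" BoolT BoolT "App P (cbr b)" TT TT v] b' v
    by (simp add: syn App_P)
  ultimately show ?thesis by (rule judg.trans)
qed

lemma ind_body_subst [simp]: "ren g (ind_body P t f (Var i)) = ind_body P t f (Var (g i))"
    "subst \<sigma> (ind_body P t f (Var i)) = ind_body P t f (\<sigma> i)"
  by (simp_all add: ind_body_def)

lemma closed_bridge_ind: "closed (bridge_ind P t f)"
  by (simp add: closed_def bridge_ind_def)

lemma bridge_ind_body: "TmV BoolBridge # es \<tturnstile> ind_body P t f (Var 0) \<Colon> El (App P (Var 0))"
proof (rule ind_body_typing)
  fix pre
  show "pre @ TmV BoolBridge # es \<tturnstile> wk (length pre) (Var 0) \<Colon> El BoolBridge"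
    by (auto intro!: var_el simp: syn nth_append)
  show "pre @ Gone # TmV BoolBridge # es \<tturnstile> wk (Suc (length pre)) (Var 0) \<Colon> El BoolBridge"
    by (auto intro!: var_el simp: syn nth_append)
qed

lemma bridge_ind: "es \<tturnstile> bridge_ind P t f \<Colon> El (PiT BoolBridge (App P (Var 0)))"
  unfolding bridge_ind_def by (intro lamI BoolBridge_type bridge_ind_body univ_simps)

lemma App_bridge_ind:
  assumes "es \<tturnstile> s \<doteq> s' \<Colon> El BoolBridge"
  shows "es \<tturnstile> App (bridge_ind P t f) s \<doteq> App (bridge_ind P t f) s' \<Colon> El (App P s)"
  by (rule appI[OF bridge_ind assms]) (simp add: syn)

lemma App_bridge_ind_cbr:
  assumes b: "(b, v) \<in> {(TT, t), (FF, f)}"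
  shows "es \<tturnstile> App (bridge_ind P t f) (cbr b) \<doteq> v \<Colon> El (App P (cbr b))"
proof -
  have "es \<tturnstile> App (bridge_ind P t f) (cbr b) \<doteq> ind_body P t f (cbr b) \<Colon> El (App P (cbr b))"
    unfolding bridge_ind_def
    by (rule betaI[OF BoolBridge_type bridge_ind_body]) (use b in \<open>auto simp: syn\<close>)
  then show ?thesis by (rule judg.trans) (rule ind_body_cbr[OF b])
qed

end

section \<open>Loosening and tightening\<close>

definition stable_eq :: "entry list \<Rightarrow> tm \<Rightarrow> tm \<Rightarrow> tm \<Rightarrow> bool" where
  "stable_eq es M N A \<longleftrightarrow>
     (\<forall>pre. pre @ es \<tturnstile> wk (length pre) M \<doteq> wk (length pre) N \<Colon> El (wk (length pre) A))"

abbreviation stable :: "entry list \<Rightarrow> tm \<Rightarrow> tm \<Rightarrow> bool" where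
  "stable es M A \<equiv> stable_eq es M M A"

lemma stable_eq_pre: "stable_eq es M N A \<Longrightarrow>
    pre @ es \<tturnstile> wk (length pre) M \<doteq> wk (length pre) N \<Colon> El (wk (length pre) A)"
  by (simp add: stable_eq_def)

lemma stable_eqD: "stable_eq es M N A \<Longrightarrow> es \<tturnstile> M \<doteq> N \<Colon> El A"
  by (frule stable_eq_pre[of _ _ _ _ "[]"]) (simp add: syn)

lemma stable_eqD_Cons: "stable_eq es M N A \<Longrightarrow> e # es \<tturnstile> ren Suc M \<doteq> ren Suc N \<Colon> El (ren Suc A)"
  by (frule stable_eq_pre[of _ _ _ _ "[e]"]) (simp add: syn)

lemma stable_Cons: "stable_eq es M N A \<Longrightarrow> stable_eq (e # es) (ren Suc M) (ren Suc N) (ren Suc A)"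
proof (subst stable_eq_def, intro allI)
  fix pre
  assume "stable_eq es M N A"
  from stable_eq_pre[OF this, of "pre @ [e]"]
  show "pre @ e # es \<tturnstile> wk (length pre) (ren Suc M) \<doteq> wk (length pre) (ren Suc N) \<Colon>
      El (wk (length pre) (ren Suc A))"
    by (simp add: syn)
qed

lemma stable_var:
  assumes "i < length es" "es ! i = TmV A" "B = wk (Suc i) A"
  shows "stable es (Var i) B"
  unfolding stable_eq_def
proof
  fix pre
  show "pre @ es \<tturnstile> wk (length pre) (Var i) \<Colon> El (wk (length pre) B)"
    using assms by (auto intro!: var_el simp: syn nth_append add.assoc add.commute[of i])
qed

lemma stable_closed:
  assumes "\<And>es. es \<tturnstile> M \<doteq> N \<Colon> El A" "closed M" "closed N" "closed A"
  shows "stable_eq es M N A"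
  using assms by (simp add: stable_eq_def syn)

lemma closed_simps [simp]: "closed TT" "closed FF" "closed BoolT" "closed BoolBridge"
  by (simp_all add: closed_def)

lemma closed_PLam [simp]: "closed M \<Longrightarrow> closed (PLam M)"
  by (subst closed_def) simp

lemma stable_bool:
  assumes "b \<in> {TT, FF}"
  shows "stable es b BoolT"
  using assms by (intro stable_closed) auto

lemma stable_trip:
  assumes "stable_eq es a a' BoolT" "stable_eq es b b' BoolT" "stable_eq es q q' (BridgeT BoolT a b)"
  shows "stable_eq es (trip a b q) (trip a' b' q') BoolBridge"
  unfolding stable_eq_def
proof
  fix pre
  have "TmV BoolT # pre @ es \<tturnstile> ren Suc (wk (length pre) a) \<Colon> El BoolT"
    using eq_left[OF stable_eq_pre[OF assms(1), of "TmV BoolT # pre"]] by (simp add: syn)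
  from trip_eq[OF _ _ _ this] show "pre @ es \<tturnstile> wk (length pre) (trip a b q) \<doteq> wk (length pre) (trip a' b' q') \<Colon>
      El (wk (length pre) BoolBridge)"
    using assms[THEN stable_eq_pre, of pre] by (simp add: syn)
qed

section \<open>Loosening of paths\<close>

lemma loosen_subst [simp]: "ren f (loosen BoolT p) = loosen BoolT (ren f p)"
  by (simp add: loosen_def syn)

text \<open>\<open>loosen\<close> places the path below binders, which is why the equality must be
  stable. The ends \<open>PApp p I0\<close> and \<open>PApp p I1\<close> of the resulting type are
  then converted to \<open>a\<close> and \<open>b\<close>.\<close>

lemma loosen_eq:
  assumes p: "stable_eq es p p' (PathT BoolT a b)"
  shows "es \<tturnstile> loosen BoolT p \<doteq> loosen BoolT p' \<Colon> El (BridgeT BoolT a b)"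
proof -
  note p0 = stable_eqD[OF p] and pw = stable_eqD_Cons[OF p, simplified]
  have P: "PathV # es \<tturnstile> BridgeT BoolT (PApp (ren Suc p) I0) (PApp (ren Suc p) (Var 0)) \<doteq>
      BridgeT BoolT (PApp (ren Suc p') I0) (PApp (ren Suc p') (Var 0)) \<Colon> Ty"
    by (intro bridge_bool pappI[OF pw]) (simp_all add: syn)
  have "es \<tturnstile> BLam (PApp (ren Suc p) I0) \<doteq> BLam (PApp (ren Suc p') I0) \<Colon>
      El (BridgeT BoolT (PApp p I0) (PApp p I0))"
    by (intro blamI) (auto intro!: pappI[OF pw] pappI[OF eq_left[OF p0]] simp: syn)
  then have "es \<tturnstile> loosen BoolT p \<doteq> loosen BoolT p' \<Colon> El (BridgeT BoolT (PApp p I0) (PApp p I1))"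
    unfolding loosen_def by (intro coeI) (use P in \<open>simp_all add: syn\<close>)
  moreover have "es \<tturnstile> BridgeT BoolT (PApp p I0) (PApp p I1) \<doteq> BridgeT BoolT a b \<Colon> Ty"
    using path_app0[OF eq_left[OF p0]] path_app1[OF eq_left[OF p0]]
    by (intro bridge_bool) (simp_all add: syn)
  ultimately show ?thesis by (rule judg.conv)
qed

text \<open>Coercion in a constant family is not assumed to be the identity. As \<open>r\<close>
  varies, this line joins the loosened constant path, at \<open>I0\<close>, to the constant bridge,
  at \<open>I1\<close>.\<close>

definition coe_line :: "tm \<Rightarrow> tm \<Rightarrow> tm" where
  "coe_line b r = Coe (BridgeT BoolT b b) r I1 (BLam b)"

lemma coe_line:
  assumes b: "b \<in> {TT, FF}"
  shows "pdim (es, []) r \<Longrightarrow> es \<tturnstile> coe_line b r \<Colon> El (BridgeT BoolT b b)"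
    and "es \<tturnstile> coe_line b I1 \<doteq> BLam b \<Colon> El (BridgeT BoolT b b)"
    and "ren f (coe_line b r) = coe_line b (ren f r)" "subst \<sigma> (coe_line b r) = coe_line b (subst \<sigma> r)"
  using assms cbr_typing(2)[OF b] unfolding coe_line_def
  by (auto intro!: coeI coe_idI bridge_bool simp: syn)

text \<open>After beta for paths, the coerced family is constantly \<open>BridgeT BoolT b b\<close>
  and the coerced element is \<open>BLam b\<close>, so the two coercions agree by
  congruence.\<close>

lemma loosen_const:
  assumes b: "b \<in> {TT, FF}" and p: "stable_eq es p (PLam b) (PathT BoolT b b)"
  shows "es \<tturnstile> loosen BoolT p \<doteq> coe_line b I0 \<Colon> El (BridgeT BoolT b b)"
proof -
  have cl [simp]: "closed b" using b by auto
  have beta: "es \<tturnstile> PApp (PLam b) r \<doteq> b \<Colon> El BoolT" if "pdim (es, []) r" for es r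
    using that b by (intro pbetaI[where A = BoolT]) (auto simp: syn)
  have "es \<tturnstile> loosen BoolT (PLam b) \<doteq> coe_line b I0 \<Colon> El (BridgeT BoolT (PApp (PLam b) I0) (PApp (PLam b) I1))"
    unfolding loosen_def coe_line_def
  proof (rule coeI)
    have "PathV # es \<tturnstile> BridgeT BoolT (PApp (PLam b) I0) (PApp (PLam b) (Var 0)) \<doteq> BridgeT BoolT b b \<Colon> Ty"
      by (intro bridge_bool beta univ_simps pdim_simps)
    then show "PathV # es \<tturnstile> BridgeT (wk 2 BoolT) (PApp (wk 1 (PLam b)) I0) (PApp (wk 1 (PLam b)) (Var 0)) \<doteq>
        BridgeT BoolT b b \<Colon> Ty"
      using b by (simp add: syn)
    have "es \<tturnstile> BLam (PApp (PLam b) I0) \<doteq> BLam b \<Colon> El (BridgeT BoolT (PApp (PLam b) I0) (PApp (PLam b) I0))"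
      by (intro blamI) (use b eq_left[OF beta] in \<open>auto intro!: beta simp: syn\<close>)
    then show "es \<tturnstile> BLam (wk 1 (PApp (PLam b) I0)) \<doteq> BLam b \<Colon>
        El (sub1 I0 (BridgeT (wk 2 BoolT) (PApp (wk 1 (PLam b)) I0) (PApp (wk 1 (PLam b)) (Var 0))))"
      using b by (auto simp: syn)
  qed (use b in \<open>simp_all add: syn\<close>)
  then have "es \<tturnstile> loosen BoolT (PLam b) \<doteq> coe_line b I0 \<Colon> El (BridgeT BoolT b b)"
    by (rule conv) (intro bridge_bool beta; simp)
  with loosen_eq[OF p] show ?thesis by (rule judg.trans)
qed

section \<open>Tightening by induction on bridges\<close>

definition path_motive :: tm where
  "path_motive = Lam (PathT BoolT (Fst (Var 0)) (Fst (Snd (Var 0))))"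

lemma Var_BoolBridge: "TmV BoolBridge # es \<tturnstile> Var 0 \<Colon> El BoolBridge"
  by (intro var_el) (auto simp: syn)

lemma App_path_motive:
  assumes "es \<tturnstile> s \<Colon> El BoolBridge"
  shows "es \<tturnstile> App path_motive s \<doteq> PathT BoolT (Fst s) (Fst (Snd s)) \<Colon> Ty"
  unfolding path_motive_def
  by (rule univ_el, rule betaI[OF BoolBridge_type _ assms, where B = UnivT])
    (auto intro!: path_bool proj_eq Var_BoolBridge simp: syn)

lemma PLam_bool:
  assumes b: "b \<in> {TT, FF}"
  shows "es \<tturnstile> PLam b \<Colon> El (PathT BoolT b b)"
  using b by (auto intro!: plamI simp: syn)

lemma cbr_proj:
  assumes b: "b \<in> {TT, FF}"
  shows "es \<tturnstile> Fst (cbr b) \<doteq> b \<Colon> El BoolT" "es \<tturnstile> Fst (Snd (cbr b)) \<doteq> b \<Colon> El BoolT"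
    "es \<tturnstile> Snd (Snd (cbr b)) \<doteq> BLam b \<Colon> El (BridgeT BoolT b b)"
  using b unfolding cbr_def by (auto intro!: proj_trip)

lemma App_path_motive_cbr:
  assumes b: "b \<in> {TT, FF}"
  shows "es \<tturnstile> App path_motive (cbr b) \<doteq> PathT BoolT b b \<Colon> Ty"
  by (rule judg.trans[OF App_path_motive path_bool]) (use b in \<open>auto intro: cbr_proj\<close>)

interpretation path_motive: bool_bridge_motive path_motive "PLam TT" "PLam FF"
proof
  show "closed path_motive" "closed (PLam TT)" "closed (PLam FF)"
    by (simp_all add: closed_def path_motive_def)
  show "es \<tturnstile> path_motive \<Colon> El (PiT BoolBridge UnivT)" for es
    unfolding path_motive_def
    by (intro lamI BoolBridge_type path_bool proj_eq Var_BoolBridge univ_simps)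
  show "es \<tturnstile> PLam TT \<Colon> El (App path_motive (cbr TT))" "es \<tturnstile> PLam FF \<Colon> El (App path_motive (cbr FF))" for es
    by (rule conv_sym[OF PLam_bool App_path_motive_cbr]; simp)+
qed

definition tighten :: tm where
  "tighten = bridge_ind path_motive (PLam TT) (PLam FF)"

lemma closed_tighten [simp]: "closed tighten"
  unfolding tighten_def by (rule path_motive.closed_bridge_ind)

lemma App_tighten:
  assumes "es \<tturnstile> s \<doteq> s' \<Colon> El BoolBridge"
  shows "es \<tturnstile> App tighten s \<doteq> App tighten s' \<Colon> El (PathT BoolT (Fst s) (Fst (Snd s)))"
  unfolding tighten_def
  by (rule conv[OF path_motive.App_bridge_ind[OF assms] App_path_motive[OF eq_left[OF assms]]])

lemma App_tighten_cbr:
  assumes b: "b \<in> {TT, FF}"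
  shows "es \<tturnstile> App tighten (cbr b) \<doteq> PLam b \<Colon> El (PathT BoolT b b)"
  unfolding tighten_def
  by (rule conv[OF path_motive.App_bridge_ind_cbr App_path_motive_cbr]) (use b in auto)

lemma stable_App_tighten:
  "stable_eq es s s' BoolBridge \<Longrightarrow>
    stable_eq es (App tighten s) (App tighten s') (PathT BoolT (Fst s) (Fst (Snd s)))"
  unfolding stable_eq_def by (auto simp: syn intro: App_tighten)

section \<open>A path from the loosened tightening of a bridge to the bridge\<close>

definition section_type :: "tm \<Rightarrow> tm" where
  "section_type s = PathT (BridgeT BoolT (Fst (ren Suc s)) (Fst (Snd (ren Suc s))))
     (loosen BoolT (App tighten s)) (Snd (Snd s))"

definition section_motive :: tm where
  "section_motive = Lam (section_type (Var 0))"

lemma section_type: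
  assumes s: "stable es s BoolBridge" and S: "univ S"
  shows "es \<tturnstile> section_type s \<Colon> S"
proof -
  note s' = stable_eqD_Cons[OF s, simplified]
  show ?thesis unfolding section_type_def
    by (intro path_formI S bridge_bool proj_eq s')
      (use loosen_eq[OF stable_App_tighten[OF s]] proj_eq(4)[OF stable_eqD[OF s]] in \<open>simp_all add: syn\<close>)
qed

lemma stable_Var_BoolBridge: "stable (TmV BoolBridge # es) (Var 0) BoolBridge"
  by (rule stable_var) (auto simp: syn)

lemma App_section_motive:
  assumes "es \<tturnstile> s \<Colon> El BoolBridge"
  shows "es \<tturnstile> App section_motive s \<doteq> section_type s \<Colon> Ty"
  unfolding section_motive_def
  by (rule univ_el, rule betaI[OF BoolBridge_type section_type[OF stable_Var_BoolBridge] assms, where B = UnivT])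
    (simp_all add: syn section_type_def loosen_def)

definition section_base :: "tm \<Rightarrow> tm" where
  "section_base b = PLam (coe_line b (Var 0))"

text \<open>On \<open>cbr b\<close>, \<open>tighten\<close> returns the constant path exactly, and
  loosening that gives \<open>coe_line b I0\<close>; so the line of coercions has the required
  ends.\<close>

lemma section_base:
  assumes b: "b \<in> {TT, FF}"
  shows "es \<tturnstile> section_base b \<Colon> El (App section_motive (cbr b))"
proof -
  have cl [simp]: "closed b" using b by auto
  have s: "stable es (cbr b) BoolBridge"
    using b by (simp add: stable_eq_def syn)
  have "stable_eq es (App tighten (cbr b)) (PLam b) (PathT BoolT b b)"
    using App_tighten_cbr[OF b] b by (auto simp: stable_eq_def syn)
  from loosen_const[OF b this]
  have l: "es \<tturnstile> loosen BoolT (App tighten (cbr b)) \<doteq> coe_line b I0 \<Colon> El (BridgeT BoolT b b)" .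
  have "es \<tturnstile> section_base b \<Colon> El (PathT (BridgeT BoolT b b) (coe_line b I0) (BLam b))"
    unfolding section_base_def
  proof (rule plamI)
    show "PathV # es \<tturnstile> BridgeT BoolT b b \<Colon> Ty"
      using b by (intro bridge_bool) auto
    show "PathV # es \<tturnstile> coe_line b (Var 0) \<Colon> El (BridgeT BoolT b b)"
      by (rule coe_line(1)[OF b]) simp
    show "es \<tturnstile> sub1 I0 (coe_line b (Var 0)) \<doteq> coe_line b I0 \<Colon> El (sub1 I0 (BridgeT BoolT b b))"
      using coe_line(1)[OF b, of es I0] b by (simp add: syn coe_line(4)[OF b])
    show "es \<tturnstile> sub1 I1 (coe_line b (Var 0)) \<doteq> BLam b \<Colon> El (sub1 I1 (BridgeT BoolT b b))"
      using coe_line(2)[OF b, of es] b by (simp add: syn coe_line(4)[OF b])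
  qed
  moreover have "es \<tturnstile> section_type (cbr b) \<doteq> PathT (BridgeT BoolT b b) (coe_line b I0) (BLam b) \<Colon> Ty"
    unfolding section_type_def
  proof (intro path_formI)
    show "PathV # es \<tturnstile> BridgeT BoolT (Fst (ren Suc (cbr b))) (Fst (Snd (ren Suc (cbr b)))) \<doteq>
        BridgeT BoolT b b \<Colon> Ty"
      using b by (intro bridge_bool) (simp_all add: cbr_proj)
    have e: "es \<tturnstile> BridgeT BoolT (Fst (cbr b)) (Fst (Snd (cbr b))) \<doteq> BridgeT BoolT b b \<Colon> Ty"
      using b by (intro bridge_bool) (simp_all add: cbr_proj)
    show "es \<tturnstile> loosen BoolT (App tighten (cbr b)) \<doteq> coe_line b I0 \<Colon>
        El (sub1 I0 (BridgeT BoolT (Fst (ren Suc (cbr b))) (Fst (Snd (ren Suc (cbr b))))))"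
      using conv_sym[OF l e] b by (simp add: syn)
    show "es \<tturnstile> Snd (Snd (cbr b)) \<doteq> BLam b \<Colon>
        El (sub1 I1 (BridgeT BoolT (Fst (ren Suc (cbr b))) (Fst (Snd (ren Suc (cbr b))))))"
      using conv_sym[OF cbr_proj(3)[OF b] e] b by (simp add: syn)
  qed simp
  ultimately have "es \<tturnstile> section_base b \<Colon> El (section_type (cbr b))"
    by (rule conv_sym)
  then show ?thesis
    by (rule conv_sym) (rule App_section_motive[OF stable_eqD[OF s]])
qed

interpretation section_motive: bool_bridge_motive section_motive "section_base TT" "section_base FF"
proof
  show "closed section_motive" "closed (section_base TT)" "closed (section_base FF)"
    unfolding closed_def section_motive_def section_type_def loosen_def section_base_def coe_line_def
    by (simp_all add: syn)
  show "es \<tturnstile> section_motive \<Colon> El (PiT BoolBridge UnivT)" for es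
    unfolding section_motive_def
    by (intro lamI BoolBridge_type section_type stable_Var_BoolBridge univ_simps)
  show "es \<tturnstile> section_base TT \<Colon> El (App section_motive (cbr TT))"
    "es \<tturnstile> section_base FF \<Colon> El (App section_motive (cbr FF))" for es
    by (simp_all add: section_base)
qed

definition loosen_section :: tm where
  "loosen_section = bridge_ind section_motive (section_base TT) (section_base FF)"

lemma closed_loosen_section [simp]: "closed loosen_section"
  unfolding loosen_section_def by (rule section_motive.closed_bridge_ind)

lemma App_loosen_section:
  assumes "es \<tturnstile> s \<Colon> El BoolBridge"
  shows "es \<tturnstile> App loosen_section s \<Colon> El (section_type s)"
  unfolding loosen_section_def
  by (rule conv[OF section_motive.App_bridge_ind[OF assms] App_section_motive[OF assms]])

section \<open>Contracting a path to its left endpoint\<close>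

definition bool_var :: "entry list \<Rightarrow> nat \<Rightarrow> bool" where
  "bool_var es i \<longleftrightarrow> i < length es \<and> es ! i = TmV BoolT"

text \<open>With the data given as indices, weakening a context merely adds to them, so typings of
  terms built from these variables hold in all weakenings. The declared type \<open>A\<close> is
  relative to its own tail and is compared after weakening.\<close>

definition path_var :: "entry list \<Rightarrow> nat \<Rightarrow> nat \<Rightarrow> nat \<Rightarrow> bool" where
  "path_var es i j k \<longleftrightarrow> bool_var es i \<and> bool_var es j \<and>
     (\<exists>A. k < length es \<and> es ! k = TmV A \<and> wk (Suc k) A = PathT BoolT (Var i) (Var j))"

lemma bool_var_Cons [simp]: "bool_var (e # es) (Suc i) = bool_var es i"
  by (simp add: bool_var_def)

lemma path_var_Cons: "path_var es i j k \<Longrightarrow> path_var (e # es) (Suc i) (Suc j) (Suc k)"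
proof -
  assume "path_var es i j k"
  then obtain A where A: "bool_var es i" "bool_var es j" "k < length es" "es ! k = TmV A"
      "wk (Suc k) A = PathT BoolT (Var i) (Var j)"
    by (auto simp: path_var_def)
  have "wk (Suc (Suc k)) A = ren Suc (wk (Suc k) A)"
    by (simp add: wk_def)
  with A show ?thesis by (simp add: path_var_def)
qed

lemma bool_var_append: "bool_var es i \<Longrightarrow> bool_var (pre @ es) (i + length pre)"
  by (induction pre) auto

lemma path_var_append: "path_var es i j k \<Longrightarrow>
    path_var (pre @ es) (i + length pre) (j + length pre) (k + length pre)"
  by (induction pre) (auto intro: path_var_Cons)

lemma bool_var_typing: "bool_var es i \<Longrightarrow> (es, cs) \<turnstile> Var i \<Colon> El BoolT"
  using judg.var[of "(es, cs)" i BoolT] by (simp add: bool_var_def entry_is_def syn)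

lemma path_var_typing:
  assumes "path_var es i j k"
  shows "(es, cs) \<turnstile> Var k \<Colon> El (PathT BoolT (Var i) (Var j))"
proof -
  from assms obtain A where A: "k < length es" "es ! k = TmV A" "wk (Suc k) A = PathT BoolT (Var i) (Var j)"
    by (auto simp: path_var_def)
  then show ?thesis using judg.var[of "(es, cs)" k A] by (simp add: entry_is_def)
qed

lemma path_varD: "path_var es i j k \<Longrightarrow> bool_var es i" "path_var es i j k \<Longrightarrow> bool_var es j"
  by (auto simp: path_var_def)

lemma stable_bool_var: "bool_var es i \<Longrightarrow> stable es (Var i) BoolT"
  by (rule stable_var) (auto simp: bool_var_def syn)

lemma stable_path_var: "path_var es i j k \<Longrightarrow> stable es (Var k) (PathT BoolT (Var i) (Var j))"
  unfolding path_var_def by (auto intro: stable_var)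

lemma pdim_Cons: "pdim (es, cs) r \<Longrightarrow> pdim (e # es, cs') (ren Suc r)"
  by (auto simp: pdim_def entry_is_def)

text \<open>With \<open>a = Var i\<close> and \<open>p = Var k\<close> a path from \<open>a\<close>, the square \<open>conn z s i k\<close> is \<open>a\<close> for \<open>z = 0\<close>
  or \<open>s = 0\<close>, and \<open>p@s\<close> for \<open>z = 1\<close>. The lid \<open>s = 1\<close> is a line in \<open>z\<close> from \<open>a\<close> to the end of \<open>p\<close>
  that need not be \<open>p\<close>.\<close>

definition conn :: "tm \<Rightarrow> tm \<Rightarrow> nat \<Rightarrow> nat \<Rightarrow> tm" where
  "conn z s i k = HCom I0 s BoolT (Var i) [(z, I0, Var (Suc i)), (z, I1, PApp (Var (Suc k)) (Var 0))]"

lemma ren_conn [simp]: "ren f (conn z s i k) = conn (ren f z) (ren f s) (f i) (f k)"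
  by (simp add: conn_def)

text \<open>The tubes, constantly \<open>a\<close> and the path itself, both start at the cap
  \<open>a\<close>; the remaining condition is their compatibility.\<close>

lemma conn_typing:
  assumes pv: "path_var es i j k" and z: "pdim (es, []) z" and s: "pdim (es, []) s"
  shows "es \<tturnstile> conn z s i k \<Colon> El BoolT"
proof -
  let ?ts = "[(z, I0, Var (Suc i)), (z, I1, PApp (Var (Suc k)) (Var 0))]"
  let ?faces = "{(I0, Var (Suc i)), (I1, PApp (Var (Suc k)) (Var 0))}"
  note pv' = path_var_Cons[OF pv, of PathV]
  have "(PathV # es, cs) \<turnstile> Var (Suc i) \<Colon> El BoolT"
    "(PathV # es, cs) \<turnstile> PApp (Var (Suc k)) (Var 0) \<Colon> El BoolT" for cs
    using bool_var_typing[OF path_varD(1)[OF pv'], of cs]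
      path_app[OF path_var_typing[OF pv', of cs], of "Var 0" "Var 0"] by (simp_all add: syn)
  then have face: "(PathV # es, cs) \<turnstile> N \<Colon> El BoolT" if "(v, N) \<in> ?faces" for v N cs
    using that by blast
  have "(es, cs) \<turnstile> sub1 I0 (Var (Suc i)) \<doteq> Var i \<Colon> El BoolT"
    "(es, cs) \<turnstile> sub1 I0 (PApp (Var (Suc k)) (Var 0)) \<doteq> Var i \<Colon> El BoolT" for cs
    using bool_var_typing[OF path_varD(1)[OF pv], of cs]
      path_app0[OF path_var_typing[OF pv, of cs]] by (simp_all add: syn)
  then have cap: "(es, cs) \<turnstile> sub1 I0 N \<doteq> Var i \<Colon> El BoolT" if "(v, N) \<in> ?faces" for v N cs
    using that by blast
  have cross: "(PathV # es, [(ren Suc z, v'), (ren Suc z, v)]) \<turnstile> N \<doteq> N' \<Colon> El BoolT"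
    if f: "(v, N) \<in> ?faces" "(v', N') \<in> ?faces" for v N v' N'
  proof (cases "v = v'")
    case True
    with f have "N = N'" by auto
    with face[OF f(1)] show ?thesis by simp
  next
    case False
    let ?\<Delta> = "(PathV # es, [(ren Suc z, v'), (ren Suc z, v)])"
    have d: "dimeq ?\<Delta> (ren Suc z) u" if "u \<in> {v, v'}" for u
      using that f pdim_Cons[OF z, of PathV "snd ?\<Delta>"]
      by (intro dimeq_assm) (auto simp: constr_def)
    have "v = I0 \<and> v' = I1 \<or> v = I1 \<and> v' = I0"
      using False f by auto
    then have "I0 \<in> {v, v'}" "I1 \<in> {v, v'}" by auto
    \<comment> \<open>Distinct faces assume both \<open>z = 0\<close> and \<open>z = 1\<close>, so
      the context is inconsistent and any two elements of \<open>BoolT\<close> agree.\<close>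
    then have "dimeq ?\<Delta> I0 I1"
      by (rule dimeq_trans[OF dimeq_sym[OF d] d])
    then show ?thesis
      by (intro absurd[OF _ face[OF f(1)] face[OF f(2)]]) (simp add: inconsistent_def)
  qed
  have face_nth: "u = z \<and> (v, N) \<in> ?faces \<and> v \<in> {I0, I1}"
    if "n < length ?ts" "?ts ! n = (u, v, N)" for n u v N
  proof -
    from that have "(u, v, N) \<in> set ?ts" by (metis nth_mem)
    then show ?thesis by auto
  qed
  show ?thesis unfolding conn_def
  proof (rule hcom)
    show "es \<tturnstile> Var i \<Colon> El BoolT"
      using pv by (intro bool_var_typing path_varD)
    fix n u v N u' v' N'
    assume n: "n < length ?ts" "?ts ! n = (u, v, N)" "?ts ! n = (u', v', N')"
    then have eq: "u' = u" "v' = v" "N' = N" by simp_all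
    have u: "u = z" and f: "(v, N) \<in> ?faces" and v: "v \<in> {I0, I1}"
      using face_nth[OF n(1,2)] by simp_all
    have "constr (es, []) (u, v)" "dimeq (es, []) u u" "dimeq (es, []) v v"
      using z v unfolding u by (auto simp: constr_def)
    with face[OF f] cap[OF f] show
      "constr (es, []) (u, v) \<and> constr (es, []) (u', v') \<and> dimeq (es, []) u u' \<and> dimeq (es, []) v v' \<and>
      (es, []) \<triangleright>\<triangleright> (u, v) \<triangleright> PathV \<turnstile> N \<doteq> N' \<Colon> El (wk 1 BoolT) \<and>
      (es, []) \<triangleright>\<triangleright> (u, v) \<turnstile> sub1 I0 N \<doteq> Var i \<Colon> El BoolT"
      unfolding eq by (simp add: ext_def assm_def wk_def)
  next
    fix n m u v N u' v' N'
    assume n: "n < length ?ts" "m < length ?ts" "?ts ! n = (u, v, N)" "?ts ! m = (u', v', N')"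
    have *: "u = z" "u' = z" "(v, N) \<in> ?faces" "(v', N') \<in> ?faces"
      using face_nth[OF n(1,3)] face_nth[OF n(2,4)] by blast+
    then have "ren Suc v = v" "ren Suc v' = v'" by auto
    with *(1,2) cross[OF *(3,4)] show "(es, []) \<triangleright>\<triangleright> (u, v) \<triangleright>\<triangleright> (u', v') \<triangleright> PathV \<turnstile> N \<doteq> N' \<Colon> El (wk 1 BoolT)"
      by (simp add: ext_def assm_def syn)
  qed (use z s in simp_all)
qed

lemma conn_boundary:
  assumes pv: "path_var es i j k"
  shows "pdim (es, []) z \<Longrightarrow> es \<tturnstile> conn z I0 i k \<doteq> Var i \<Colon> El BoolT"
    and "pdim (es, []) s \<Longrightarrow> es \<tturnstile> conn I0 s i k \<doteq> Var i \<Colon> El BoolT"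
    and "pdim (es, []) s \<Longrightarrow> es \<tturnstile> conn I1 s i k \<doteq> PApp (Var k) s \<Colon> El BoolT"
proof -
  show "es \<tturnstile> conn z I0 i k \<doteq> Var i \<Colon> El BoolT" if "pdim (es, []) z"
    using hcom_cap[OF conn_typing[OF pv that, of I0, unfolded conn_def]] by (simp add: conn_def)
  show "es \<tturnstile> conn I0 s i k \<doteq> Var i \<Colon> El BoolT" if s: "pdim (es, []) s"
    using hcom_tube[OF conn_typing[OF pv _ s, of I0, unfolded conn_def], of I0 I0 "Var (Suc i)"]
    by (simp add: conn_def syn)
  show "es \<tturnstile> conn I1 s i k \<doteq> PApp (Var k) s \<Colon> El BoolT" if s: "pdim (es, []) s"
    using hcom_tube[OF conn_typing[OF pv _ s, of I1, unfolded conn_def], of I1 I1 "PApp (Var (Suc k)) (Var 0)"]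
    by (simp add: conn_def syn)
qed

text \<open>As \<open>z\<close> varies, a line of paths from the constant path at
  \<open>Var i\<close> to \<open>Var k\<close>, whose right end \<open>conn z I1 i k\<close> moves
  along. This is the contraction of the space of paths based at the left endpoint.\<close>

definition contr :: "tm \<Rightarrow> nat \<Rightarrow> nat \<Rightarrow> tm" where
  "contr z i k = PLam (conn (ren Suc z) (Var 0) (Suc i) (Suc k))"

lemma ren_contr [simp]: "ren f (contr z i k) = contr (ren f z) (f i) (f k)"
  by (simp add: contr_def)

text \<open>The body \<open>M\<close> is arbitrary so that typing and the values at
  \<open>z = 0\<close> and \<open>z = 1\<close> are all instances.\<close>

lemma contr_typing:
  assumes pv: "path_var es i j k" and z: "pdim (es, []) z"
    and M: "PathV # es \<tturnstile> conn (ren Suc z) (Var 0) (Suc i) (Suc k) \<doteq> M \<Colon> El BoolT"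
  shows "es \<tturnstile> contr z i k \<doteq> PLam M \<Colon> El (PathT BoolT (Var i) (conn z I1 i k))"
  unfolding contr_def
proof (rule plamI[OF _ M])
  show "es \<tturnstile> sub1 I0 (conn (ren Suc z) (Var 0) (Suc i) (Suc k)) \<doteq> Var i \<Colon> El (sub1 I0 BoolT)"
    using conn_boundary(1)[OF pv z] by (simp add: conn_def syn)
  show "es \<tturnstile> sub1 I1 (conn (ren Suc z) (Var 0) (Suc i) (Suc k)) \<doteq> conn z I1 i k \<Colon> El (sub1 I1 BoolT)"
    using conn_typing[OF pv z, of I1] by (simp add: conn_def syn)
qed simp

lemma stable_conn:
  assumes pv: "path_var es i j k"
  shows "stable_eq es (conn I0 I1 i k) (Var i) BoolT"
    and "stable_eq es (conn I1 I1 i k) (Var j) BoolT"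
    and "stable (PathV # es) (conn (Var 0) I1 (Suc i) (Suc k)) BoolT"
proof -
  note pv' = path_var_append[OF pv]
  show "stable_eq es (conn I0 I1 i k) (Var i) BoolT"
    unfolding stable_eq_def using conn_boundary(2)[OF pv'] by (simp add: syn)
  have "pre @ es \<tturnstile> conn I1 I1 (i + length pre) (k + length pre) \<doteq> Var (j + length pre) \<Colon> El BoolT" for pre
  proof (rule judg.trans[OF conn_boundary(3)[OF pv']])
    show "pre @ es \<tturnstile> PApp (Var (k + length pre)) I1 \<doteq> Var (j + length pre) \<Colon> El BoolT"
      using path_app1[OF path_var_typing[OF pv', of pre "[]"]] by (simp add: syn)
  qed simp
  then show "stable_eq es (conn I1 I1 i k) (Var j) BoolT"
    unfolding stable_eq_def by (simp add: syn)
  show "stable (PathV # es) (conn (Var 0) I1 (Suc i) (Suc k)) BoolT"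
    unfolding stable_eq_def
    using conn_typing[OF path_var_append[OF path_var_Cons[OF pv]], of _ PathV]
    by (auto simp: syn pdim_def entry_is_def nth_append)
qed

lemma stable_contr:
  assumes pv: "path_var es i j k"
  shows "stable_eq es (contr I0 i k) (PLam (Var (Suc i))) (PathT BoolT (Var i) (conn I0 I1 i k))"
    and "stable_eq es (contr I1 i k) (Var k) (PathT BoolT (Var i) (conn I1 I1 i k))"
    and "stable (PathV # es) (contr (Var 0) (Suc i) (Suc k))
      (PathT BoolT (Var (Suc i)) (conn (Var 0) I1 (Suc i) (Suc k)))"
proof -
  have 0: "es \<tturnstile> contr I0 i k \<doteq> PLam (Var (Suc i)) \<Colon> El (PathT BoolT (Var i) (conn I0 I1 i k))"
    if "path_var es i j k" for es i j k
    using contr_typing[OF that, of I0] conn_boundary(2)[OF path_var_Cons[OF that], of PathV "Var 0"] by simp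
  show "stable_eq es (contr I0 i k) (PLam (Var (Suc i))) (PathT BoolT (Var i) (conn I0 I1 i k))"
    unfolding stable_eq_def using 0[OF path_var_append[OF pv]] by (simp add: syn)
  have 1: "es \<tturnstile> contr I1 i k \<doteq> Var k \<Colon> El (PathT BoolT (Var i) (conn I1 I1 i k))"
    if pv: "path_var es i j k" for es i j k
  proof -
    have "es \<tturnstile> contr I1 i k \<doteq> PLam (PApp (Var (Suc k)) (Var 0)) \<Colon> El (PathT BoolT (Var i) (conn I1 I1 i k))"
      using contr_typing[OF pv, of I1] conn_boundary(3)[OF path_var_Cons[OF pv], of PathV "Var 0"] by simp
    moreover have "es \<tturnstile> PLam (PApp (Var (Suc k)) (Var 0)) \<doteq> Var k \<Colon> El (PathT BoolT (Var i) (Var j))"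
      using judg.sym[OF path_eta[OF path_var_typing[OF pv]]] by (simp add: syn)
    \<comment> \<open>Eta types the path with right end \<open>Var j\<close>, which is exactly equal
      to the corner \<open>conn I1 I1 i k\<close>.\<close>
    then have "es \<tturnstile> PLam (PApp (Var (Suc k)) (Var 0)) \<doteq> Var k \<Colon> El (PathT BoolT (Var i) (conn I1 I1 i k))"
      by (rule conv_sym)
        (intro path_bool bool_var_typing path_varD[OF pv] stable_eqD[OF stable_conn(2)[OF pv]] univ_simps)
    ultimately show ?thesis by (rule judg.trans)
  qed
  show "stable_eq es (contr I1 i k) (Var k) (PathT BoolT (Var i) (conn I1 I1 i k))"
    unfolding stable_eq_def using 1[OF path_var_append[OF pv]] by (simp add: syn)
  show "stable (PathV # es) (contr (Var 0) (Suc i) (Suc k))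
      (PathT BoolT (Var (Suc i)) (conn (Var 0) I1 (Suc i) (Suc k)))"
    unfolding stable_eq_def
  proof
    fix pre
    let ?es = "pre @ PathV # es" and ?n = "length pre"
    have pv': "path_var ?es (Suc i + ?n) (Suc j + ?n) (Suc k + ?n)"
      by (rule path_var_append[OF path_var_Cons[OF pv]])
    have z: "pdim (?es, []) (Var ?n)" by (simp add: pdim_def entry_is_def nth_append)
    from eq_left[OF contr_typing[OF pv' z conn_typing[OF path_var_Cons[OF pv'] pdim_Cons[OF z]]]]
    show "?es \<tturnstile> wk ?n (contr (Var 0) (Suc i) (Suc k)) \<Colon>
        El (wk ?n (PathT BoolT (Var (Suc i)) (conn (Var 0) I1 (Suc i) (Suc k))))"
      by (simp add: syn)
  qed
qed


section \<open>The retraction\<close>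

lemma App_tighten_trip:
  assumes a: "stable_eq es a a' BoolT" and b: "stable_eq es b b' BoolT"
    and q: "es \<tturnstile> q \<doteq> q' \<Colon> El (BridgeT BoolT a b)"
  shows "es \<tturnstile> App tighten (trip a b q) \<doteq> App tighten (trip a' b' q') \<Colon> El (PathT BoolT a b)"
proof (rule conv[OF App_tighten path_bool])
  note w = eq_left[OF stable_eqD_Cons[OF a, of "TmV BoolT"], simplified]
  show "es \<tturnstile> trip a b q \<doteq> trip a' b' q' \<Colon> El BoolBridge"
    by (rule trip_eq[OF stable_eqD[OF a] stable_eqD[OF b] q w])
  note p = proj_trip[OF eq_left[OF stable_eqD[OF a]] eq_left[OF stable_eqD[OF b]] eq_left[OF q] w]
  show "es \<tturnstile> Fst (trip a b q) \<doteq> a \<Colon> El BoolT" "es \<tturnstile> Fst (Snd (trip a b q)) \<doteq> b \<Colon> El BoolT"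
    by (fact p)+
qed simp

definition retraction_type :: "tm \<Rightarrow> tm \<Rightarrow> tm \<Rightarrow> tm" where
  "retraction_type a b p =
     PathT (PathT BoolT (ren Suc a) (ren Suc b)) (App tighten (trip a b (loosen BoolT p))) p"

lemma retraction_type:
  assumes a: "stable es a BoolT" and b: "stable_eq es b b' BoolT"
    and p: "stable_eq es p p' (PathT BoolT a b)"
  shows "es \<tturnstile> retraction_type a b p \<doteq> retraction_type a b' p' \<Colon> Ty"
  unfolding retraction_type_def
proof (rule path_formI)
  show "PathV # es \<tturnstile> PathT BoolT (ren Suc a) (ren Suc b) \<doteq> PathT BoolT (ren Suc a) (ren Suc b') \<Colon> Ty"
    using stable_eqD_Cons[OF a] stable_eqD_Cons[OF b] by (intro path_bool) simp_all
  show "es \<tturnstile> App tighten (trip a b (loosen BoolT p)) \<doteq> App tighten (trip a b' (loosen BoolT p')) \<Colon>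
      El (sub1 I0 (PathT BoolT (ren Suc a) (ren Suc b)))"
    using App_tighten_trip[OF a b loosen_eq[OF p]] by (simp add: syn)
  show "es \<tturnstile> p \<doteq> p' \<Colon> El (sub1 I1 (PathT BoolT (ren Suc a) (ren Suc b)))"
    using stable_eqD[OF p] by (simp add: syn)
qed simp

definition retraction_const :: "tm \<Rightarrow> tm" where
  "retraction_const b = PLam (App tighten (trip b b (coe_line b (Var 0))))"

text \<open>At \<open>I0\<close> the line of bridges is the loosened constant path; at
  \<open>I1\<close> it is the constant bridge, which \<open>tighten\<close> sends exactly to
  \<open>PLam b\<close>.\<close>

lemma retraction_const:
  assumes b: "b \<in> {TT, FF}"
  shows "es \<tturnstile> retraction_const b \<Colon> El (retraction_type b b (PLam b))"
proof -
  have cl [simp]: "closed b" using b by auto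
  note sb = stable_bool[OF b]
  have sub: "subst \<sigma> (App tighten (trip b b (coe_line b r))) = App tighten (trip b b (coe_line b (subst \<sigma> r)))" for \<sigma> r
    by (simp add: coe_line(4)[OF b])
  have "stable es (PLam b) (PathT BoolT b b)"
    using PLam_bool[OF b] by (simp add: stable_eq_def syn)
  then have l: "es \<tturnstile> coe_line b I0 \<doteq> loosen BoolT (PLam b) \<Colon> El (BridgeT BoolT b b)"
    by (rule judg.sym[OF loosen_const[OF b]])
  show ?thesis unfolding retraction_const_def retraction_type_def
  proof (rule plamI)
    show "PathV # es \<tturnstile> PathT BoolT (ren Suc b) (ren Suc b) \<Colon> Ty"
      using b by (intro path_bool) auto
    show "PathV # es \<tturnstile> App tighten (trip b b (coe_line b (Var 0))) \<Colon> El (PathT BoolT (ren Suc b) (ren Suc b))"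
      using App_tighten_trip[OF sb sb coe_line(1)[OF b], of "PathV # es" "Var 0"] by simp
    show "es \<tturnstile> sub1 I0 (App tighten (trip b b (coe_line b (Var 0)))) \<doteq>
        App tighten (trip b b (loosen BoolT (PLam b))) \<Colon> El (sub1 I0 (PathT BoolT (ren Suc b) (ren Suc b)))"
      using App_tighten_trip[OF sb sb l] sub by (simp add: syn)
    have "es \<tturnstile> App tighten (trip b b (coe_line b I1)) \<doteq> PLam b \<Colon> El (PathT BoolT b b)"
      using App_tighten_trip[OF sb sb coe_line(2)[OF b]] App_tighten_cbr[OF b]
      by (auto simp: cbr_def intro: judg.trans)
    then show "es \<tturnstile> sub1 I1 (App tighten (trip b b (coe_line b (Var 0)))) \<doteq> PLam b \<Colon>
        El (sub1 I1 (PathT BoolT (ren Suc b) (ren Suc b)))"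
      using sub by (simp add: syn)
  qed
qed

text \<open>The computation rule of \<open>tighten\<close> is available at \<open>TT\<close> and
  \<open>FF\<close>, so a constant path at a variable is treated by cases on that variable. Below
  \<open>PLam\<close> the motive variable has index 1.\<close>

definition retraction_refl :: "nat \<Rightarrow> tm" where
  "retraction_refl i = If (retraction_type (Var 0) (Var 0) (PLam (Var (Suc 0)))) (Var i)
     (retraction_const TT) (retraction_const FF)"

lemma stable_refl:
  assumes "bool_var es i"
  shows "stable es (PLam (Var (Suc i))) (PathT BoolT (Var i) (Var i))"
  unfolding stable_eq_def
proof
  fix pre
  note bv = bool_var_append[OF assms, of pre]
  have "pre @ es \<tturnstile> PLam (Var (Suc (i + length pre))) \<Colon>
      El (PathT BoolT (Var (i + length pre)) (Var (i + length pre)))"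
    using bv by (intro plamI) (auto intro!: bool_var_typing simp: syn)
  then show "pre @ es \<tturnstile> wk (length pre) (PLam (Var (Suc i))) \<Colon>
      El (wk (length pre) (PathT BoolT (Var i) (Var i)))"
    by (simp add: syn)
qed

lemma retraction_type_subst:
  "sub1 N (retraction_type (Var 0) (Var 0) (PLam (Var (Suc 0)))) = retraction_type N N (PLam (ren Suc N))"
  by (simp add: retraction_type_def loosen_def syn)

lemma retraction_refl:
  assumes i: "bool_var es i"
  shows "es \<tturnstile> retraction_refl i \<Colon> El (retraction_type (Var i) (Var i) (PLam (Var (Suc i))))"
proof -
  have bv: "bool_var (TmV BoolT # es) 0" by (simp add: bool_var_def)
  have "(es, []) \<triangleright> TmV BoolT \<turnstile> retraction_type (Var 0) (Var 0) (PLam (Var (Suc 0))) \<Colon> Ty"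
    using retraction_type[OF stable_bool_var[OF bv] stable_bool_var[OF bv] stable_refl[OF bv]] by simp
  from bool_if[OF this bool_var_typing[OF i], of "retraction_const TT" "retraction_const TT"
      "retraction_const FF" "retraction_const FF"]
  show ?thesis
    using retraction_const[of TT es] retraction_const[of FF es]
    by (simp add: retraction_refl_def retraction_type_subst)
qed

text \<open>Path induction as a coercion: along the contraction, the constant case at
  \<open>z = 0\<close> is carried to the given path at \<open>z = 1\<close>.\<close>

definition retraction :: "nat \<Rightarrow> nat \<Rightarrow> tm" where
  "retraction i k = Coe (retraction_type (Var (Suc i)) (conn (Var 0) I1 (Suc i) (Suc k))
     (contr (Var 0) (Suc i) (Suc k))) I0 I1 (retraction_refl i)"

lemma retraction:
  assumes pv: "path_var es i j k"
  shows "es \<tturnstile> retraction i k \<Colon> El (retraction_type (Var i) (Var j) (Var k))"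
proof -
  let ?A = "retraction_type (Var (Suc i)) (conn (Var 0) I1 (Suc i) (Suc k)) (contr (Var 0) (Suc i) (Suc k))"
  note i = stable_bool_var[OF path_varD(1)[OF pv]]
  have sub: "sub1 r ?A = retraction_type (Var i) (conn r I1 i k) (contr r i k)" if "r \<in> {I0, I1}" for r
    using that by (auto simp: retraction_type_def loosen_def conn_def contr_def syn)
  have A: "PathV # es \<tturnstile> ?A \<Colon> Ty"
    by (intro retraction_type stable_conn(3)[OF pv] stable_contr(3)[OF pv] stable_bool_var)
      (use path_varD(1)[OF pv] in simp)
  \<comment> \<open>At \<open>I0\<close> the moving end is \<open>Var i\<close> and the path is
    constant, so the coerced type is that of the constant case.\<close>
  have base: "es \<tturnstile> retraction_refl i \<Colon> El (sub1 I0 ?A)"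
    using conv_sym[OF retraction_refl[OF path_varD(1)[OF pv]]
        retraction_type[OF i stable_conn(1)[OF pv] stable_contr(1)[OF pv]]] by (simp add: sub)
  have "es \<tturnstile> retraction i k \<Colon> El (sub1 I1 ?A)"
    unfolding retraction_def by (intro coeI A base) simp_all
  then show ?thesis
    using retraction_type[OF i stable_conn(2)[OF pv] stable_contr(2)[OF pv]]
    by (simp add: sub judg.conv)
qed

section \<open>The equivalence\<close>

definition loosen_fun :: tm where
  "loosen_fun = Lam (loosen BoolT (Var 0))"

text \<open>\<open>tighten\<close> for fixed endpoints, as a function of the bridge alone; it is the
  inverse in both halves of \<open>isEquiv\<close>.\<close>

definition tighten_at :: "nat \<Rightarrow> nat \<Rightarrow> tm" where
  "tighten_at i j = Lam (App tighten (trip (Var (Suc i)) (Var (Suc j)) (Var 0)))"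

lemma closed_loosen_fun [simp]: "closed loosen_fun"
  unfolding closed_def by (simp add: loosen_fun_def loosen_def syn)

lemma ren_tighten_at [simp]: "ren f (tighten_at i j) = tighten_at (f i) (f j)"
  by (simp add: tighten_at_def)

context
  fixes es :: "entry list" and i j :: nat
  assumes i: "bool_var es i" and j: "bool_var es j"
begin

lemma path_bool_var: "univ S \<Longrightarrow> es \<tturnstile> PathT BoolT (Var i) (Var j) \<Colon> S"
  using i j by (intro path_bool bool_var_typing)

lemma bridge_bool_var: "univ S \<Longrightarrow> es \<tturnstile> BridgeT BoolT (Var i) (Var j) \<Colon> S"
  using i j by (intro bridge_bool bool_var_typing)

lemma path_var_0: "path_var (TmV (PathT BoolT (Var i) (Var j)) # es) (Suc i) (Suc j) 0"
  using i j by (simp add: path_var_def syn)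

lemma stable_bridge_0: "stable (TmV (BridgeT BoolT (Var i) (Var j)) # es) (Var 0) (BridgeT BoolT (Var (Suc i)) (Var (Suc j)))"
  by (rule stable_var) (auto simp: syn)

lemma loosen_fun_body:
  "TmV (PathT BoolT (Var i) (Var j)) # es \<tturnstile> loosen BoolT (Var 0) \<Colon> El (BridgeT BoolT (Var (Suc i)) (Var (Suc j)))"
  by (rule loosen_eq[OF stable_path_var[OF path_var_0]])

lemma loosen_fun: "es \<tturnstile> loosen_fun \<Colon> El (PiT (PathT BoolT (Var i) (Var j)) (BridgeT BoolT (Var (Suc i)) (Var (Suc j))))"
  unfolding loosen_fun_def by (intro lamI path_bool_var loosen_fun_body univ_simps)

lemma App_loosen_fun_type:
  assumes "es \<tturnstile> p \<Colon> El (PathT BoolT (Var i) (Var j))"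
  shows "es \<tturnstile> App loosen_fun p \<Colon> El (BridgeT BoolT (Var i) (Var j))"
  by (rule appI[OF loosen_fun assms]) (simp add: syn)

lemma App_loosen_fun:
  assumes "es \<tturnstile> p \<Colon> El (PathT BoolT (Var i) (Var j))"
  shows "es \<tturnstile> App loosen_fun p \<doteq> loosen BoolT p \<Colon> El (BridgeT BoolT (Var i) (Var j))"
  unfolding loosen_fun_def
  by (rule betaI[OF path_bool_var loosen_fun_body assms]) (simp_all add: syn loosen_def)

lemma tighten_at_body:
  "TmV (BridgeT BoolT (Var i) (Var j)) # es \<tturnstile> App tighten (trip (Var (Suc i)) (Var (Suc j)) (Var 0)) \<Colon>
    El (PathT BoolT (Var (Suc i)) (Var (Suc j)))"
  using i j by (intro App_tighten_trip stable_bool_var stable_eqD[OF stable_bridge_0]) simp_all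

lemma tighten_at: "es \<tturnstile> tighten_at i j \<Colon>
    El (PiT (BridgeT BoolT (Var i) (Var j)) (PathT BoolT (Var (Suc i)) (Var (Suc j))))"
  unfolding tighten_at_def by (intro lamI bridge_bool_var tighten_at_body univ_simps)

lemma App_tighten_at:
  assumes "es \<tturnstile> q \<Colon> El (BridgeT BoolT (Var i) (Var j))"
  shows "es \<tturnstile> App (tighten_at i j) q \<doteq> App tighten (trip (Var i) (Var j) q) \<Colon> El (PathT BoolT (Var i) (Var j))"
  unfolding tighten_at_def
  by (rule betaI[OF bridge_bool_var tighten_at_body assms]) (simp_all add: syn)

end

section \<open>Conversion to the types demanded by \<open>isEquiv\<close>\<close>

lemma stable_App_tighten_at:
  assumes i: "bool_var es i" and j: "bool_var es j" and q: "stable es q (BridgeT BoolT (Var i) (Var j))"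
  shows "stable_eq es (App tighten (trip (Var i) (Var j) q)) (App (tighten_at i j) q) (PathT BoolT (Var i) (Var j))"
  unfolding stable_eq_def
proof
  fix pre
  have "pre @ es \<tturnstile> wk (length pre) q \<Colon> El (BridgeT BoolT (Var (i + length pre)) (Var (j + length pre)))"
    using stable_eq_pre[OF q, of pre] by (simp add: syn)
  from judg.sym[OF App_tighten_at[OF bool_var_append[OF i] bool_var_append[OF j] this]]
  show "pre @ es \<tturnstile> wk (length pre) (App tighten (trip (Var i) (Var j) q)) \<doteq>
      wk (length pre) (App (tighten_at i j) q) \<Colon> El (wk (length pre) (PathT BoolT (Var i) (Var j)))"
    by (simp add: syn)
qed

text \<open>Projections of the triple reduce to its components, and \<open>loosen_fun\<close> and
  \<open>tighten_at\<close> beta-reduce to \<open>loosen\<close> and \<open>tighten\<close>.\<close>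

lemma section_type_at:
  assumes i: "bool_var es i" and j: "bool_var es j" and q: "stable es q (BridgeT BoolT (Var i) (Var j))"
  shows "es \<tturnstile> section_type (trip (Var i) (Var j) q) \<doteq>
    PathT (BridgeT BoolT (Var (Suc i)) (Var (Suc j))) (App loosen_fun (App (tighten_at i j) q)) q \<Colon> Ty"
  unfolding section_type_def
proof (rule path_formI)
  let ?s = "trip (Var i) (Var j) q" and ?B = "BridgeT BoolT (Var i) (Var j)"
  let ?A = "BridgeT BoolT (Fst (ren Suc ?s)) (Fst (Snd (ren Suc ?s)))"
  note st = stable_bool_var[OF i] stable_bool_var[OF j]
  \<comment> \<open>Stated for arbitrary contexts, since the projections occur both in
    \<open>es\<close> and below the path binder of the type.\<close>
  have proj: "es \<tturnstile> Fst (trip a b q) \<doteq> a \<Colon> El BoolT" "es \<tturnstile> Fst (Snd (trip a b q)) \<doteq> b \<Colon> El BoolT"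
    "es \<tturnstile> Snd (Snd (trip a b q)) \<doteq> q \<Colon> El (BridgeT BoolT a b)"
    if "stable es a BoolT" "stable es b BoolT" "stable es q (BridgeT BoolT a b)" for es a b q
    using that[THEN stable_eqD] stable_eqD_Cons[OF that(1), of "TmV BoolT"]
    by (intro proj_trip; simp)+
  show "PathV # es \<tturnstile> ?A \<doteq> BridgeT BoolT (Var (Suc i)) (Var (Suc j)) \<Colon> Ty"
    using proj[OF stable_Cons[OF st(1), of PathV, simplified] stable_Cons[OF st(2), of PathV, simplified]
        stable_Cons[OF q, of PathV, simplified]]
    by (intro bridge_bool) simp_all
  have B: "es \<tturnstile> BridgeT BoolT (Fst ?s) (Fst (Snd ?s)) \<doteq> ?B \<Colon> Ty"
    by (intro bridge_bool proj st q univ_simps)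
  note t = stable_App_tighten_at[OF i j q]
  have "es \<tturnstile> App loosen_fun (App (tighten_at i j) q) \<doteq> loosen BoolT (App (tighten_at i j) q) \<Colon> El ?B"
    by (rule App_loosen_fun[OF i j eq_right[OF stable_eqD[OF t]]])
  from judg.trans[OF loosen_eq[OF t] judg.sym[OF this]] B
  show "es \<tturnstile> loosen BoolT (App tighten ?s) \<doteq> App loosen_fun (App (tighten_at i j) q) \<Colon> El (sub1 I0 ?A)"
    by (simp add: syn conv_sym)
  show "es \<tturnstile> Snd (Snd ?s) \<doteq> q \<Colon> El (sub1 I1 ?A)"
    using conv_sym[OF proj(3)[OF st q] B] by (simp add: syn)
qed simp

lemma retraction_type_at:
  assumes pv: "path_var es i j k"
  shows "es \<tturnstile> retraction_type (Var i) (Var j) (Var k) \<doteq>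
    PathT (PathT BoolT (Var (Suc i)) (Var (Suc j))) (App (tighten_at i j) (App loosen_fun (Var k))) (Var k) \<Colon> Ty"
  unfolding retraction_type_def
proof (rule path_formI)
  note ij = path_varD[OF pv]
  note p = path_var_typing[OF pv, of "[]"]
  show "PathV # es \<tturnstile> PathT BoolT (ren Suc (Var i)) (ren Suc (Var j)) \<doteq>
      PathT BoolT (Var (Suc i)) (Var (Suc j)) \<Colon> Ty"
    using ij by (intro path_bool) (simp_all add: bool_var_typing)
  have "es \<tturnstile> App tighten (trip (Var i) (Var j) (loosen BoolT (Var k))) \<doteq>
      App tighten (trip (Var i) (Var j) (App loosen_fun (Var k))) \<Colon> El (PathT BoolT (Var i) (Var j))"
    by (intro App_tighten_trip stable_bool_var ij judg.sym[OF App_loosen_fun[OF ij p]])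
  from judg.trans[OF this judg.sym[OF App_tighten_at[OF ij App_loosen_fun_type[OF ij p]]]]
  show "es \<tturnstile> App tighten (trip (Var i) (Var j) (loosen BoolT (Var k))) \<doteq>
      App (tighten_at i j) (App loosen_fun (Var k)) \<Colon> El (sub1 I0 (PathT BoolT (ren Suc (Var i)) (ren Suc (Var j))))"
    by (simp add: syn)
  show "es \<tturnstile> Var k \<Colon> El (sub1 I1 (PathT BoolT (ren Suc (Var i)) (ren Suc (Var j))))"
    using p by (simp add: syn)
qed simp

text \<open>The pair rule asks for the type of the second component over every candidate inverse, so
  the inverse is a variable here.\<close>

lemma section_fun_type:
  assumes i: "bool_var es i" and j: "bool_var es j"
  shows "TmV (PiT (BridgeT BoolT (Var i) (Var j)) (PathT BoolT (Var (Suc i)) (Var (Suc j)))) # es \<tturnstile>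
    PiT (BridgeT BoolT (Var (Suc i)) (Var (Suc j))) (PathT (BridgeT BoolT (Var (Suc (Suc (Suc i)))) (Var (Suc (Suc (Suc j)))))
      (App loosen_fun (App (Var 1) (Var 0))) (Var 0)) \<Colon> Ty" (is "?G # es \<tturnstile> PiT ?B _ \<Colon> Ty")
proof (rule pi_formI)
  show "?G # es \<tturnstile> ?B \<Colon> Ty" using i j by (intro bridge_bool_var) simp_all
  let ?es = "TmV ?B # ?G # es"
  have b: "?es \<tturnstile> Var 0 \<Colon> El (BridgeT BoolT (Var (Suc (Suc i))) (Var (Suc (Suc j))))"
    by (rule var_el) (auto simp: syn)
  have "?es \<tturnstile> Var 1 \<Colon> El (PiT (BridgeT BoolT (Var (Suc (Suc i))) (Var (Suc (Suc j))))
      (PathT BoolT (Var (Suc (Suc (Suc i)))) (Var (Suc (Suc (Suc j))))))"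
    by (rule var_el) (auto simp: syn)
  from appI[OF this b, of "PathT BoolT (Var (Suc (Suc i))) (Var (Suc (Suc j)))"]
  have "?es \<tturnstile> App (Var 1) (Var 0) \<Colon> El (PathT BoolT (Var (Suc (Suc i))) (Var (Suc (Suc j))))"
    by (simp add: syn)
  from App_loosen_fun_type[OF _ _ this] i j
  have "?es \<tturnstile> App loosen_fun (App (Var 1) (Var 0)) \<Colon> El (BridgeT BoolT (Var (Suc (Suc i))) (Var (Suc (Suc j))))"
    by simp
  with b i j show "?es \<tturnstile> PathT (BridgeT BoolT (Var (Suc (Suc (Suc i)))) (Var (Suc (Suc (Suc j)))))
      (App loosen_fun (App (Var 1) (Var 0))) (Var 0) \<Colon> Ty"
    by (intro path_formI bridge_bool_var) (simp_all add: syn)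
qed simp

lemma retraction_fun_type:
  assumes i: "bool_var es i" and j: "bool_var es j"
  shows "TmV (PiT (BridgeT BoolT (Var i) (Var j)) (PathT BoolT (Var (Suc i)) (Var (Suc j)))) # es \<tturnstile>
    PiT (PathT BoolT (Var (Suc i)) (Var (Suc j))) (PathT (PathT BoolT (Var (Suc (Suc (Suc i)))) (Var (Suc (Suc (Suc j)))))
      (App (Var 1) (App loosen_fun (Var 0))) (Var 0)) \<Colon> Ty" (is "?G # es \<tturnstile> PiT ?A _ \<Colon> Ty")
proof (rule pi_formI)
  show "?G # es \<tturnstile> ?A \<Colon> Ty" using i j by (intro path_bool_var) simp_all
  let ?es = "TmV ?A # ?G # es"
  have p: "?es \<tturnstile> Var 0 \<Colon> El (PathT BoolT (Var (Suc (Suc i))) (Var (Suc (Suc j))))"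
    by (rule var_el) (auto simp: syn)
  from App_loosen_fun_type[OF _ _ this] i j
  have b: "?es \<tturnstile> App loosen_fun (Var 0) \<Colon> El (BridgeT BoolT (Var (Suc (Suc i))) (Var (Suc (Suc j))))"
    by simp
  have "?es \<tturnstile> Var 1 \<Colon> El (PiT (BridgeT BoolT (Var (Suc (Suc i))) (Var (Suc (Suc j))))
      (PathT BoolT (Var (Suc (Suc (Suc i)))) (Var (Suc (Suc (Suc j))))))"
    by (rule var_el) (auto simp: syn)
  from appI[OF this b, of "PathT BoolT (Var (Suc (Suc i))) (Var (Suc (Suc j)))"]
  have "?es \<tturnstile> App (Var 1) (App loosen_fun (Var 0)) \<Colon> El (PathT BoolT (Var (Suc (Suc i))) (Var (Suc (Suc j))))"
    by (simp add: syn)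
  with p i j show "?es \<tturnstile> PathT (PathT BoolT (Var (Suc (Suc (Suc i)))) (Var (Suc (Suc (Suc j)))))
      (App (Var 1) (App loosen_fun (Var 0))) (Var 0) \<Colon> Ty"
    by (intro path_formI path_bool_var) (simp_all add: syn)
qed simp

section \<open>Assembling the equivalence\<close>

lemma section_typing:
  assumes i: "bool_var es i" and j: "bool_var es j"
  shows "es \<tturnstile> Pr (tighten_at i j) (Lam (App loosen_section (trip (Var (Suc i)) (Var (Suc j)) (Var 0)))) \<Colon>
    El (hasSection (PathT BoolT (Var i) (Var j)) (BridgeT BoolT (Var i) (Var j)) loosen_fun)"
proof -
  let ?B = "BridgeT BoolT (Var i) (Var j)" and ?s = "trip (Var (Suc i)) (Var (Suc j)) (Var 0)"
  note q = stable_bridge_0[OF i j]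
  have ij: "bool_var (TmV ?B # es) (Suc i)" "bool_var (TmV ?B # es) (Suc j)"
    using i j by simp_all
  have "TmV ?B # es \<tturnstile> ?s \<Colon> El BoolBridge"
    by (rule stable_eqD[OF stable_trip[OF stable_bool_var[OF ij(1)] stable_bool_var[OF ij(2)] q]])
  from conv[OF App_loosen_section[OF this] section_type_at[OF ij q]]
  have "es \<tturnstile> Lam (App loosen_section ?s) \<Colon> El (PiT ?B (PathT (BridgeT BoolT (Var (Suc (Suc i))) (Var (Suc (Suc j))))
      (App loosen_fun (App (tighten_at (Suc i) (Suc j)) (Var 0))) (Var 0)))"
    by (intro lamI bridge_bool_var i j univ_simps)
  then show ?thesis unfolding hasSection_def
    using section_fun_type[OF i j] tighten_at[OF i j]
    by (intro sig_pair) (simp_all add: arr_def syn)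
qed

lemma retraction_typing:
  assumes i: "bool_var es i" and j: "bool_var es j"
  shows "es \<tturnstile> Pr (tighten_at i j) (Lam (retraction (Suc i) 0)) \<Colon>
    El (hasRetraction (PathT BoolT (Var i) (Var j)) (BridgeT BoolT (Var i) (Var j)) loosen_fun)"
proof -
  let ?A = "PathT BoolT (Var i) (Var j)"
  note pv = path_var_0[OF i j]
  from conv[OF retraction[OF pv] retraction_type_at[OF pv]]
  have "es \<tturnstile> Lam (retraction (Suc i) 0) \<Colon> El (PiT ?A (PathT (PathT BoolT (Var (Suc (Suc i))) (Var (Suc (Suc j))))
      (App (tighten_at (Suc i) (Suc j)) (App loosen_fun (Var 0))) (Var 0)))"
    by (intro lamI path_bool_var i j univ_simps)
  then show ?thesis unfolding hasRetraction_def
    using retraction_fun_type[OF i j] tighten_at[OF i j]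
    by (intro sig_pair) (simp_all add: arr_def syn)
qed

lemma hasRetraction_type:
  assumes i: "bool_var es i" and j: "bool_var es j"
  shows "es \<tturnstile> hasRetraction (PathT BoolT (Var i) (Var j)) (BridgeT BoolT (Var i) (Var j)) loosen_fun \<Colon> Ty"
  unfolding hasRetraction_def
proof (rule sig_form)
  show "es \<tturnstile> arr (BridgeT BoolT (Var i) (Var j)) (PathT BoolT (Var i) (Var j)) \<Colon> Ty"
    using i j unfolding arr_def
    by (intro pi_formI bridge_bool_var) (auto intro!: path_bool_var simp: syn)
qed (use retraction_fun_type[OF i j] in \<open>simp_all add: arr_def syn\<close>)

lemma isEquiv_loosen_fun:
  assumes i: "bool_var es i" and j: "bool_var es j"
  shows "\<exists>M. es \<tturnstile> M \<Colon> El (isEquiv (PathT BoolT (Var i) (Var j)) (BridgeT BoolT (Var i) (Var j)) loosen_fun)"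
proof -
  let ?R = "\<lambda>i j. hasRetraction (PathT BoolT (Var i) (Var j)) (BridgeT BoolT (Var i) (Var j)) loosen_fun"
  \<comment> \<open>The type of the retraction half does not mention the section half, so weakening
    and instantiation cancel.\<close>
  have wk: "wk 1 (?R i j) = ?R (Suc i) (Suc j)" and sub: "sub1 M (?R (Suc i) (Suc j)) = ?R i j" for M
    by (simp_all add: hasRetraction_def arr_def syn)
  have "(es, []) \<triangleright> TmV (hasSection (PathT BoolT (Var i) (Var j)) (BridgeT BoolT (Var i) (Var j)) loosen_fun) \<turnstile>
      ?R (Suc i) (Suc j) \<Colon> Ty"
    using i j by (simp add: hasRetraction_type)
  from sig_pair[OF section_typing[OF i j] this, unfolded sub, OF retraction_typing[OF i j]]
  show ?thesis unfolding isEquiv_def wk by blast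
qed

theorem theorem11p5:
  shows "is_bridge_discrete BoolT"
proof -
  have "bool_var [TmV BoolT, TmV BoolT] 1" "bool_var [TmV BoolT, TmV BoolT] 0"
    by (simp_all add: bool_var_def)
  from isEquiv_loosen_fun[OF this] obtain M where
    "[TmV BoolT, TmV BoolT] \<tturnstile> M \<Colon> El (isEquiv (PathT BoolT (Var 1) (Var 0)) (BridgeT BoolT (Var 1) (Var 0)) loosen_fun)"
    by blast
  \<comment> \<open>The abstractions bind the two endpoints, \<open>Var 1\<close> and
    \<open>Var 0\<close>.\<close>
  then have "[] \<tturnstile> Lam (Lam M) \<Colon> El (bridgeDiscrete BoolT)"
    unfolding bridgeDiscrete_def by (intro lamI) (simp_all add: loosen_fun_def syn)
  then show ?thesis
    unfolding is_bridge_discrete_def inhabited_def by blast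
qed

end
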